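(* Let $\Omega\subset\mathbb{C}^2$ be a smoothly bounded, pseudoconvex domain. Assume that $\Omega$ is weakly pseudoconvex at $p_0\in b\Omega$. Let $r\colon U\to\mathbb{R}$ be a smooth local defining function for $\Omega$ on an open neighborhood $U$ of $p_0$, let $L$ be a nonvanishing holomorphic tangential vector field on $U$, and set $\lambda:=H_r(L,L)|_{b\Omega\cap U}$. Then $(L\bar L\lambda)(p_0)$ is real and $$(L\bar L\lambda)(p_0)\ \ge\ |(LL\lambda)(p_0)|.$$
   Context: "Smooth" means $\mathcal{C}^\infty$; "smoothly bounded" means that the boundary $b\Omega$ is smooth. A smooth function $r\colon U\to\mathbb{R}$ is a local defining function for $\Omega$ near $p_0\in b\Omega$ if $U$ is an open neighborhood of $p_0$, $\Omega\cap U=\{r<0\}$, and $dr\ne0$ on $b\Omega\cap U$. A "holomorphic vector field" on $U$ means a smooth vector field of type $(1,0)$, $L=L^1\frac{\partial}{\partial z^1}+L^2\frac{\partial}{\partial z^2}$ with smooth complex coefficients; it is tangential if $Lr=0$ on $b\Omega\cap U$. For $(1,0)$ vector fields $A,B$, $H_f(A,B)=\sum_{j,k}\frac{\partial^2f}{\partial z^j\partial\bar z^k}A^j\overline{B^k}$. $\Omega$ is pseudoconvex at $p\in b\Omega$ if $H_r(L,L)\ge0$ on $b\Omega$ near $p$ for all holomorphic tangential $L$; strictly pseudoconvex at $p$ if in addition the inequality is strict whenever $L$ is nonvanishing; weakly pseudoconvex at $p$ if pseudoconvex but not strictly pseudoconvex at $p$. $L\bar L\lambda=L(\bar L\lambda)$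 and $LL\lambda=L(L\lambda)$ denote iterated derivatives along $b\Omega$ (well defined because $L,\bar L$ are tangential). *)

theory Defs
  imports "HOL-Analysis.Analysis"
begin

text \<open>
  Functions on an open set \<open>U\<close> are total functions of which only the values on \<open>U\<close>
  matter.  Both predicates below are meant for open \<open>U\<close> only.
\<close>

primrec Ck_on :: "nat \<Rightarrow> ('a::real_normed_vector \<Rightarrow> 'b::real_normed_vector) \<Rightarrow> 'a set \<Rightarrow> bool" where
  "Ck_on 0 f U \<longleftrightarrow> continuous_on U f"
| "Ck_on (Suc k) f U \<longleftrightarrow>
     (\<forall>x\<in>U. f differentiable (at x)) \<and> (\<forall>v. Ck_on k (\<lambda>x. frechet_derivative f (at x) v) U)"

definition smooth_on :: "'a::real_normed_vector set \<Rightarrow> ('a \<Rightarrow> 'b::real_normed_vector) \<Rightarrow> bool" where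
  "smooth_on U f \<longleftrightarrow> (\<forall>k. Ck_on k f U)"

text \<open>
  The Wirtinger derivatives \<open>\<partial>/\<partial>z\<^sup>j\<close> and \<open>\<partial>/\<partial>\<bar>z\<^sup>j\<close>, where \<open>z\<^sup>j = x\<^sup>j + \<i> y\<^sup>j\<close>; the real directional
  derivative along \<open>axis j 1\<close> is \<open>\<partial>/\<partial>x\<^sup>j\<close> and that along \<open>axis j \<i>\<close> is \<open>\<partial>/\<partial>y\<^sup>j\<close>.
\<close>

definition dz :: "2 \<Rightarrow> (complex^2 \<Rightarrow> complex) \<Rightarrow> complex^2 \<Rightarrow> complex" where
  "dz j f p = (frechet_derivative f (at p) (axis j 1) - \<i> * frechet_derivative f (at p) (axis j \<i>)) / 2"

definition dzbar :: "2 \<Rightarrow> (complex^2 \<Rightarrow> complex) \<Rightarrow> complex^2 \<Rightarrow> complex" where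
  "dzbar j f p = (frechet_derivative f (at p) (axis j 1) + \<i> * frechet_derivative f (at p) (axis j \<i>)) / 2"

text \<open>
  A vector field \<open>L = L\<^sup>1 \<partial>/\<partial>z\<^sup>1 + L\<^sup>2 \<partial>/\<partial>z\<^sup>2\<close> of type (1,0) is represented by its coefficient
  vector; \<open>vf L\<close> and \<open>vf_bar L\<close> are the derivations \<open>L\<close> and \<open>\<bar>L\<close>.  ``Holomorphic'' refers to
  the type (1,0): the coefficients are smooth, not necessarily holomorphic.
\<close>

definition hol_vector_field :: "(complex^2) set \<Rightarrow> (complex^2 \<Rightarrow> complex^2) \<Rightarrow> bool" where
  "hol_vector_field U L \<longleftrightarrow> (\<forall>j. smooth_on U (\<lambda>p. L p $ j))"

definition vf :: "(complex^2 \<Rightarrow> complex^2) \<Rightarrow> (complex^2 \<Rightarrow> complex) \<Rightarrow> complex^2 \<Rightarrow> complex" where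
  "vf L f p = (\<Sum>j\<in>UNIV. L p $ j * dz j f p)"

definition vf_bar :: "(complex^2 \<Rightarrow> complex^2) \<Rightarrow> (complex^2 \<Rightarrow> complex) \<Rightarrow> complex^2 \<Rightarrow> complex" where
  "vf_bar L f p = (\<Sum>j\<in>UNIV. cnj (L p $ j) * dzbar j f p)"

definition hess_form ::
  "(complex^2 \<Rightarrow> complex) \<Rightarrow> (complex^2 \<Rightarrow> complex^2) \<Rightarrow> (complex^2 \<Rightarrow> complex^2) \<Rightarrow> complex^2 \<Rightarrow> complex" where
  "hess_form f A B p =
     (\<Sum>j\<in>UNIV. \<Sum>k\<in>UNIV. dz j (dzbar k f) p * A p $ j * cnj (B p $ k))"

abbreviation cplx :: "(complex^2 \<Rightarrow> real) \<Rightarrow> complex^2 \<Rightarrow> complex" where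
  "cplx r \<equiv> (\<lambda>p. complex_of_real (r p))"

definition local_defining_function ::
  "(complex^2) set \<Rightarrow> complex^2 \<Rightarrow> (complex^2) set \<Rightarrow> (complex^2 \<Rightarrow> real) \<Rightarrow> bool" where
  "local_defining_function \<Omega> p U r \<longleftrightarrow>
     p \<in> frontier \<Omega> \<and> open U \<and> p \<in> U \<and> smooth_on U r \<and>
     \<Omega> \<inter> U = {q \<in> U. r q < 0} \<and>
     (\<forall>q \<in> frontier \<Omega> \<inter> U. frechet_derivative r (at q) \<noteq> (\<lambda>_. 0))"

definition smoothly_bounded_domain :: "(complex^2) set \<Rightarrow> bool" where
  "smoothly_bounded_domain \<Omega> \<longleftrightarrow>
     open \<Omega> \<and> connected \<Omega> \<and> \<Omega> \<noteq> {} \<and> (\<forall>p \<in> frontier \<Omega>. \<exists>U r. local_defining_function \<Omega> p U r)"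

definition tangential ::
  "(complex^2) set \<Rightarrow> (complex^2) set \<Rightarrow> (complex^2 \<Rightarrow> real) \<Rightarrow> (complex^2 \<Rightarrow> complex^2) \<Rightarrow> bool" where
  "tangential \<Omega> U r L \<longleftrightarrow> (\<forall>q \<in> frontier \<Omega> \<inter> U. vf L (cplx r) q = 0)"

definition nonvanishing_on :: "(complex^2) set \<Rightarrow> (complex^2 \<Rightarrow> complex^2) \<Rightarrow> bool" where
  "nonvanishing_on U L \<longleftrightarrow> (\<forall>q \<in> U. L q \<noteq> 0)"

text \<open>
  The conditions are imposed for every local defining function \<open>r\<close> near \<open>p\<close>, on an arbitrary
  neighborhood \<open>U\<close>, and for every field on that \<open>U\<close>; so they cover fields that are defined only
  close to \<open>p\<close>.  Since \<open>r\<close> is real-valued, \<open>hess_form (cplx r) L L\<close> is real, and taking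
  \<open>Re\<close> only adjusts the type.
\<close>

definition pseudoconvex_at :: "(complex^2) set \<Rightarrow> complex^2 \<Rightarrow> bool" where
  "pseudoconvex_at \<Omega> p \<longleftrightarrow> p \<in> frontier \<Omega> \<and>
     (\<forall>U r L. local_defining_function \<Omega> p U r \<and> hol_vector_field U L \<and> tangential \<Omega> U r L \<longrightarrow>
        (\<forall>\<^sub>F q in nhds p. q \<in> frontier \<Omega> \<longrightarrow> 0 \<le> Re (hess_form (cplx r) L L q)))"

definition strictly_pseudoconvex_at :: "(complex^2) set \<Rightarrow> complex^2 \<Rightarrow> bool" where
  "strictly_pseudoconvex_at \<Omega> p \<longleftrightarrow> pseudoconvex_at \<Omega> p \<and>
     (\<forall>U r L. local_defining_function \<Omega> p U r \<and> hol_vector_field U L \<and> tangential \<Omega> U r L \<and>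
          nonvanishing_on U L \<longrightarrow>
        (\<forall>\<^sub>F q in nhds p. q \<in> frontier \<Omega> \<longrightarrow> 0 < Re (hess_form (cplx r) L L q)))"

definition weakly_pseudoconvex_at :: "(complex^2) set \<Rightarrow> complex^2 \<Rightarrow> bool" where
  "weakly_pseudoconvex_at \<Omega> p \<longleftrightarrow> pseudoconvex_at \<Omega> p \<and> \<not> strictly_pseudoconvex_at \<Omega> p"

definition pseudoconvex :: "(complex^2) set \<Rightarrow> bool" where
  "pseudoconvex \<Omega> \<longleftrightarrow> (\<forall>p \<in> frontier \<Omega>. pseudoconvex_at \<Omega> p)"

text \<open>
  A function on the hypersurface \<open>b\<Omega> \<inter> U\<close> is differentiated along tangential fields through a
  smooth extension to \<open>U\<close>; on \<open>b\<Omega> \<inter> U\<close> the result does not depend on the extension.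
\<close>

definition extends_levi_function ::
  "(complex^2) set \<Rightarrow> (complex^2) set \<Rightarrow> (complex^2 \<Rightarrow> real) \<Rightarrow> (complex^2 \<Rightarrow> complex^2) \<Rightarrow>
   (complex^2 \<Rightarrow> complex) \<Rightarrow> bool" where
  "extends_levi_function \<Omega> U r L lam \<longleftrightarrow>
     smooth_on U lam \<and> (\<forall>q \<in> frontier \<Omega> \<inter> U. lam q = hess_form (cplx r) L L q)"

end

(* Since dr is not 0 on the boundary, every real tangent vector v there is a limit of directions
   of boundary points q_n = p + t_n h_n with t_n -> 0, h_n -> v (cross the boundary on short
   segments transverse to it).  Hence tangential derivatives of functions that vanish on the
   boundary vanish again; no curves and no flows are needed.

   Applied to the conjugate of L r = 0 this gives H_r(L,L) = - sum_k (L conj(L^k)) dr/dzbar^k on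
   the boundary.  The right-hand side depends on r only through dr, so whether the Levi form
   vanishes at p0 does not depend on r and L, and weak pseudoconvexity forces lambda(p0) = 0.

   Now lambda restricted to the boundary has a minimum at p0.  With mu chosen so that
   W = lambda - mu r has dW(p0) = 0, the second derivative D of W at p0 is real and nonnegative on
   tangent vectors v, being the limit of 2 W(q_n) / t_n^2.  For the tangent vectors a = L(p0) and
   b = i a this yields L Lbar lambda = (D(a,a) + D(b,b)) / 4 and
   L L lambda = (D(a,a) - D(b,b) - 2 i D(a,b)) / 4, and D(a,b)^2 <= D(a,a) D(b,b). *)
theory Submission
  imports Defs
begin

section \<open>Tangent directions of the boundary as limits of secants, and first derivatives along
  them\<close>

section \<open>Contingent cones of boundaries\<close>

text \<open>The Bouligand tangent cone in sequential form. The directions \<open>h n\<close> may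
  vary with \<open>n\<close>, so membership never requires a curve in \<open>S\<close> with velocity
  \<open>v\<close>.\<close>

definition contingent_cone :: "'a::real_normed_vector set \<Rightarrow> 'a \<Rightarrow> 'a set" where
  "contingent_cone S p = {v. \<exists>t h. (\<forall>n. 0 < t n) \<and> t \<longlonglongrightarrow> 0 \<and> h \<longlonglongrightarrow> v \<and>
     (\<forall>n::nat. p + t n *\<^sub>R h n \<in> S)}"

lemma in_contingent_coneI:
  assumes "\<And>e. 0 < e \<Longrightarrow> \<exists>t h. 0 < t \<and> t < e \<and> dist h v < e \<and> p + t *\<^sub>R h \<in> S"
  shows "v \<in> contingent_cone S p"
proof -
  have "\<exists>t h. 0 < t \<and> t < inverse (real (Suc n)) \<and> dist h v < inverse (real (Suc n)) \<and> p + t *\<^sub>R h \<in> S" for n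
    by (rule assms) simp
  then obtain t h where th: "\<And>n. 0 < t n" "\<And>n. t n < inverse (real (Suc n))"
      "\<And>n. dist (h n) v < inverse (real (Suc n))" "\<And>n. p + t n *\<^sub>R h n \<in> S"
    by metis
  have "t \<longlonglongrightarrow> 0"
  proof (rule real_tendsto_sandwich)
    show "\<forall>\<^sub>F n in sequentially. 0 \<le> t n" using th(1) by (simp add: less_imp_le)
    show "\<forall>\<^sub>F n in sequentially. t n \<le> inverse (real (Suc n))"
      using less_imp_le[OF th(2)] by (intro always_eventually allI)
    show "(\<lambda>n. inverse (real (Suc n))) \<longlonglongrightarrow> 0" by (rule LIMSEQ_inverse_real_of_nat)
  qed (rule tendsto_const)
  moreover have "h \<longlonglongrightarrow> v"
  proof (rule tendsto_dist_iff[THEN iffD2], rule real_tendsto_sandwich)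
    show "\<forall>\<^sub>F n in sequentially. 0 \<le> dist (h n) v" by simp
    show "\<forall>\<^sub>F n in sequentially. dist (h n) v \<le> inverse (real (Suc n))"
      using less_imp_le[OF th(3)] by (intro always_eventually allI)
    show "(\<lambda>n. inverse (real (Suc n))) \<longlonglongrightarrow> 0" by (rule LIMSEQ_inverse_real_of_nat)
  qed (rule tendsto_const)
  ultimately show ?thesis
    unfolding contingent_cone_def mem_Collect_eq using th(1,4) by (intro exI[of _ t] exI[of _ h] conjI allI)
qed

text \<open>The remainder of the linear approximation is o(\<open>t n * norm (h n)\<close>), and
  \<open>h n\<close> is bounded because it converges. Division by \<open>t n\<close> therefore
  leaves \<open>f' (h n)\<close> up to a null sequence, and \<open>f'\<close> is continuous.\<close>

lemma has_derivative_sequential_quotient: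
  assumes "(f has_derivative f') (at p)" "\<And>n. 0 < t n" "t \<longlonglongrightarrow> 0" "h \<longlonglongrightarrow> v"
  shows "(\<lambda>n. (f (p + t n *\<^sub>R h n) - f p) /\<^sub>R t n) \<longlonglongrightarrow> f' v"
proof -
  interpret f': bounded_linear f' using assms(1) by (rule has_derivative_bounded_linear)
  define q where "q n = (f (p + t n *\<^sub>R h n) - f p) /\<^sub>R t n" for n
  have th0: "(\<lambda>n. t n *\<^sub>R h n) \<longlonglongrightarrow> 0"
    using tendsto_scaleR[OF assms(3,4)] by simp
  have hb: "eventually (\<lambda>n. norm (h n) < norm v + 1) sequentially"
    using order_tendstoD(2)[OF tendsto_norm[OF assms(4)]] by simp
  have "(\<lambda>n. q n - f' (h n)) \<longlonglongrightarrow> 0"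
    unfolding tendsto_iff dist_norm
  proof (intro allI impI)
    fix e :: real assume "0 < e"
    \<comment> \<open>The denominator is positive even for \<open>v = 0\<close> and exceeds
      \<open>norm v + 1\<close>, the eventual bound on \<open>norm (h n)\<close>.\<close>
    define e' where "e' = e / (norm v + 2)"
    have "0 < e'" using \<open>0 < e\<close> unfolding e'_def
      by (intro divide_pos_pos) (auto simp: add_nonneg_pos)
    then obtain d where d: "d > 0"
      "\<And>y. norm (y - p) < d \<Longrightarrow> norm (f y - f p - f' (y - p)) \<le> e' * norm (y - p)"
      using assms(1) unfolding has_derivative_at_alt by metis
    have "eventually (\<lambda>n. norm (t n *\<^sub>R h n) < d) sequentially"
      using order_tendstoD(2)[OF tendsto_norm[OF th0]] d(1) by simp
    then show "eventually (\<lambda>n. norm (q n - f' (h n) - 0) < e) sequentially"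
      using hb
    proof eventually_elim
      case (elim n)
      have "norm (f (p + t n *\<^sub>R h n) - f p - t n *\<^sub>R f' (h n)) \<le> e' * (t n * norm (h n))"
        using d(2)[of "p + t n *\<^sub>R h n"] elim assms(2)[of n] by (simp add: f'.scaleR)
      moreover have "q n - f' (h n) = (f (p + t n *\<^sub>R h n) - f p - t n *\<^sub>R f' (h n)) /\<^sub>R t n"
        unfolding q_def using assms(2)[of n] by (simp add: algebra_simps)
      ultimately have "norm (q n - f' (h n)) \<le> e' * norm (h n)"
        using assms(2)[of n] by (simp add: divide_simps mult.commute mult.left_commute)
      also have "\<dots> < e' * (norm v + 2)"
        using elim(2) \<open>0 < e'\<close> by (intro mult_strict_left_mono) auto
      also have "\<dots> = e"
        unfolding e'_def using add_nonneg_pos[OF norm_ge_zero[of v], of 2] by simp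
      finally show ?case by simp
    qed
  qed
  moreover have "(\<lambda>n. f' (h n)) \<longlonglongrightarrow> f' v"
    using f'.tendsto[OF assms(4)] .
  ultimately have "(\<lambda>n. (q n - f' (h n)) + f' (h n)) \<longlonglongrightarrow> 0 + f' v"
    by (rule tendsto_add)
  then show ?thesis by (simp add: q_def)
qed

lemma has_derivative_ray_quotient:
  assumes "(f has_derivative f') (at p)"
  shows "((\<lambda>t. (f (p + t *\<^sub>R v) - f p) /\<^sub>R t) \<longlongrightarrow> f' v) (at_right 0)"
proof (rule tendsto_at_right_sequentially[of 0 1])
  fix S :: "nat \<Rightarrow> real"
  assume "\<And>n. 0 < S n" "S \<longlonglongrightarrow> 0"
  then show "(\<lambda>n. (f (p + S n *\<^sub>R v) - f p) /\<^sub>R S n) \<longlonglongrightarrow> f' v"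
    by (intro has_derivative_sequential_quotient[OF assms]) auto
qed simp

text \<open>A negative value would put \<open>p\<close> into the open set \<open>\<Omega>\<close>,
  which misses its frontier; a positive value would give a neighborhood of \<open>p\<close> disjoint
  from \<open>\<Omega>\<close>, although \<open>p\<close> lies in the closure.\<close>

lemma defining_function_zero_on_frontier:
  fixes r :: "'a::real_normed_vector \<Rightarrow> real"
  assumes "open \<Omega>" "p \<in> frontier \<Omega>" "open U" "p \<in> U" "\<Omega> \<inter> U = {q\<in>U. r q < 0}" "isCont r p"
  shows "r p = 0"
proof (rule antisym)
  show "0 \<le> r p"
  proof (rule ccontr)
    assume "\<not> 0 \<le> r p"
    then have "p \<in> \<Omega>" using assms(4,5) by force
    then show False using assms(1,2) by (simp add: frontier_def interior_open)
  qed
  show "r p \<le> 0"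
  proof (rule ccontr)
    assume "\<not> r p \<le> 0"
    then have "0 < r p" by simp
    moreover have "(r \<longlongrightarrow> r p) (nhds p)"
      using assms(6) by (simp add: isCont_def tendsto_at_iff_tendsto_nhds)
    ultimately have "eventually (\<lambda>x. 0 < r x) (nhds p)"
      by (simp add: order_tendstoD(1))
    then obtain V where V: "open V" "p \<in> V" "\<And>x. x \<in> V \<Longrightarrow> 0 < r x"
      unfolding eventually_nhds by blast
    then have "V \<inter> U \<inter> \<Omega> = {}" using assms(5) by force
    then show False
      using V(1,2) assms(2-4) open_Int_closure_eq_empty[of "V \<inter> U" \<Omega>] open_Int[of V U]
      unfolding frontier_def by blast
  qed
qed

text \<open>Take \<open>u\<close> with \<open>r' u = 1\<close>. For small \<open>t > 0\<close> the
  function \<open>r\<close> is positive at \<open>p + t (v + d u)\<close> and negative at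
  \<open>p + t (v - d u)\<close>; the segment between these two points is connected, so it meets the
  frontier at some \<open>p + t (v + s u)\<close> with \<open>\<bar>s\<bar> \<le> d\<close>.\<close>

lemma contingent_cone_frontier:
  fixes r :: "'a::real_normed_vector \<Rightarrow> real"
  assumes "open \<Omega>" "p \<in> frontier \<Omega>" "open U" "p \<in> U" "\<Omega> \<inter> U = {q\<in>U. r q < 0}"
    and r': "(r has_derivative r') (at p)" "r' \<noteq> (\<lambda>_. 0)" and v: "r' v = 0"
  shows "v \<in> contingent_cone (frontier \<Omega>) p"
proof (rule in_contingent_coneI)
  fix e :: real assume "0 < e"
  interpret r': bounded_linear r' using r'(1) by (rule has_derivative_bounded_linear)
  have rp: "r p = 0"
    using assms(1-5) has_derivative_continuous[OF r'(1)] by (rule defining_function_zero_on_frontier)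
  obtain w where w: "r' w \<noteq> 0" using r'(2) by blast
  define u where "u = w /\<^sub>R r' w"
  have u: "r' u = 1" using w by (simp add: u_def r'.scaleR)
  \<comment> \<open>Small enough that every direction \<open>v + s u\<close> with
    \<open>\<bar>s\<bar> \<le> d\<close> stays within \<open>e\<close> of \<open>v\<close>.\<close>
  define d where "d = e / (2 * (norm u + 1))"
  have d: "0 < d" "d * norm u < e"
  proof -
    have "0 < norm u + 1" using norm_ge_zero[of u] by linarith
    then show "0 < d" using \<open>0 < e\<close> by (simp add: d_def)
    have "d * norm u \<le> d * (norm u + 1)" using \<open>0 < d\<close> by simp
    also have "\<dots> = e / 2" using \<open>0 < norm u + 1\<close> by (simp add: d_def field_simps)
    finally show "d * norm u < e" using \<open>0 < e\<close> by simp
  qed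
  have lim: "((\<lambda>t. p + t *\<^sub>R a) \<longlongrightarrow> p) (at_right 0)" for a
    using tendsto_add[OF tendsto_const[of p] tendsto_scaleR[OF tendsto_ident_at[of 0] tendsto_const[of a]]] by simp
  have inU: "eventually (\<lambda>t. p + t *\<^sub>R a \<in> U) (at_right 0)" for a
    using lim assms(3,4) by (rule topological_tendstoD)
  have "eventually (\<lambda>t. 0 < (r (p + t *\<^sub>R (v + d *\<^sub>R u)) - r p) /\<^sub>R t) (at_right 0)"
    using order_tendstoD(1)[OF has_derivative_ray_quotient[OF r'(1)], of 0 "v + d *\<^sub>R u"] v u d
    by (simp add: r'.add r'.scaleR)
  moreover have "eventually (\<lambda>t. (r (p + t *\<^sub>R (v - d *\<^sub>R u)) - r p) /\<^sub>R t < 0) (at_right 0)"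
    using order_tendstoD(2)[OF has_derivative_ray_quotient[OF r'(1)], of "v - d *\<^sub>R u" 0] v u d
    by (simp add: r'.diff r'.scaleR)
  moreover have "eventually (\<lambda>t. 0 < t \<and> t < e) (at_right (0::real))"
    using \<open>0 < e\<close> by (auto simp: eventually_at_right)
  ultimately have "eventually (\<lambda>t. 0 < t \<and> t < e \<and> p + t *\<^sub>R (v + d *\<^sub>R u) \<notin> \<Omega> \<and> p + t *\<^sub>R (v - d *\<^sub>R u) \<in> \<Omega>) (at_right 0)"
    using inU[of "v + d *\<^sub>R u"] inU[of "v - d *\<^sub>R u"]
  proof eventually_elim
    case (elim t)
    then have "0 < r (p + t *\<^sub>R (v + d *\<^sub>R u))" "r (p + t *\<^sub>R (v - d *\<^sub>R u)) < 0"
      by (auto simp: rp zero_less_mult_iff mult_less_0_iff)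
    then show ?case using elim assms(5) by force
  qed
  then obtain t where t: "0 < t" "t < e" "p + t *\<^sub>R (v + d *\<^sub>R u) \<notin> \<Omega>" "p + t *\<^sub>R (v - d *\<^sub>R u) \<in> \<Omega>"
    using eventually_happens'[OF trivial_limit_at_right_real] by blast
  let ?S = "(\<lambda>s. p + t *\<^sub>R (v + s *\<^sub>R u)) ` {-d..d}"
  have "?S \<inter> frontier \<Omega> \<noteq> {}"
  proof (rule connected_Int_frontier)
    show "connected ?S"
      by (intro connected_continuous_image continuous_intros) simp
    have "p + t *\<^sub>R (v - d *\<^sub>R u) \<in> ?S"
      by (rule image_eqI[of _ _ "- d"]) (use d in auto)
    with t(4) show "?S \<inter> \<Omega> \<noteq> {}" by blast
    have "p + t *\<^sub>R (v + d *\<^sub>R u) \<in> ?S"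
      by (rule image_eqI[of _ _ d]) (use d in auto)
    with t(3) show "?S - \<Omega> \<noteq> {}" by blast
  qed
  then obtain s where "s \<in> {-d..d}" and sF: "p + t *\<^sub>R (v + s *\<^sub>R u) \<in> frontier \<Omega>" by blast
  then have s: "\<bar>s\<bar> \<le> d" by auto
  have "dist (v + s *\<^sub>R u) v < e"
    using mult_right_mono[OF s norm_ge_zero[of u]] d(2) by (simp add: dist_norm)
  then show "\<exists>t h. 0 < t \<and> t < e \<and> dist h v < e \<and> p + t *\<^sub>R h \<in> frontier \<Omega>"
    using t(1,2) sF by blast
qed

lemma contingent_coneE:
  assumes "v \<in> contingent_cone S p" "open U" "p \<in> U"
  obtains t h where "\<And>n. 0 < t n" "t \<longlonglongrightarrow> 0" "h \<longlonglongrightarrow> v"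
    "\<forall>\<^sub>F n in sequentially. p + t n *\<^sub>R h n \<in> S \<inter> U"
proof -
  obtain t h where th: "\<And>n. 0 < t n" "t \<longlonglongrightarrow> 0" "h \<longlonglongrightarrow> v" "\<And>n::nat. p + t n *\<^sub>R h n \<in> S"
    using assms(1) unfolding contingent_cone_def by blast
  have "(\<lambda>n. p + t n *\<^sub>R h n) \<longlonglongrightarrow> p"
    using tendsto_add[OF tendsto_const[of p] tendsto_scaleR[OF th(2,3)]] by simp
  then have "\<forall>\<^sub>F n in sequentially. p + t n *\<^sub>R h n \<in> U"
    using assms(2,3) by (rule topological_tendstoD)
  then have "\<forall>\<^sub>F n in sequentially. p + t n *\<^sub>R h n \<in> S \<inter> U"
    by eventually_elim (use th(4) in simp)
  with th(1-3) show thesis by (rule that)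
qed

text \<open>Since \<open>f p = 0\<close>, the difference quotients at points of \<open>S\<close> are
  positive multiples of values of \<open>f\<close>, hence lie in \<open>K\<close>, and closedness
  passes to the limit. It serves for \<open>K = {0}\<close> and for the nonnegative reals inside the
  complex plane.\<close>

lemma derivative_in_closed_cone:
  assumes "(f has_derivative f') (at p)" "v \<in> contingent_cone S p" "open U" "p \<in> U" "f p = 0"
    "closed K" "cone K" "\<And>x. x \<in> S \<inter> U \<Longrightarrow> f x \<in> K"
  shows "f' v \<in> K"
proof -
  obtain t h where th: "\<And>n. 0 < t n" "t \<longlonglongrightarrow> 0" "h \<longlonglongrightarrow> v"
    "\<forall>\<^sub>F n in sequentially. p + t n *\<^sub>R h n \<in> S \<inter> U"
    using contingent_coneE[OF assms(2-4)] by blast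
  have "\<forall>\<^sub>F n in sequentially. (f (p + t n *\<^sub>R h n) - f p) /\<^sub>R t n \<in> K"
    using th(4)
  proof eventually_elim
    case (elim n)
    show ?case using mem_cone[OF assms(7) assms(8)[OF elim], of "inverse (t n)"] th(1)[of n] assms(5) by simp
  qed
  from Lim_in_closed_set[OF assms(6) this trivial_limit_sequentially
      has_derivative_sequential_quotient[OF assms(1) th(1-3)]]
  show ?thesis .
qed

lemma derivative_zero_on_contingent_cone:
  assumes "(f has_derivative f') (at p)" "v \<in> contingent_cone S p" "open U" "p \<in> U" "f p = 0"
    "\<And>x. x \<in> S \<inter> U \<Longrightarrow> f x = 0"
  shows "f' v = 0"
  using derivative_in_closed_cone[OF assms(1-5), of "{0}"] assms(6) by (simp add: cone_def)

section \<open>Second derivatives at a point: bilinearity, symmetry and a second-order Taylor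
  limit\<close>

section \<open>Second derivatives\<close>

text \<open>The first derivative is differentiated for each fixed direction \<open>v\<close>
  separately, so no normed space of linear maps enters.\<close>

definition twice_differentiable_at ::
  "('a::real_normed_vector \<Rightarrow> 'b::real_normed_vector) \<Rightarrow> 'a \<Rightarrow> bool" where
  "twice_differentiable_at f p \<longleftrightarrow> (\<forall>\<^sub>F x in nhds p. f differentiable (at x)) \<and>
     (\<forall>v. (\<lambda>x. frechet_derivative f (at x) v) differentiable (at p))"

definition second_derivative ::
  "('a::real_normed_vector \<Rightarrow> 'b::real_normed_vector) \<Rightarrow> 'a \<Rightarrow> 'a \<Rightarrow> 'a \<Rightarrow> 'b" where
  "second_derivative f p u v = frechet_derivative (\<lambda>x. frechet_derivative f (at x) v) (at p) u"

lemma twice_differentiable_at_imp_differentiable: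
  "twice_differentiable_at f p \<Longrightarrow> f differentiable (at p)"
  unfolding twice_differentiable_at_def using eventually_nhds_x_imp_x by blast

lemma has_derivative_frechet_derivative:
  "twice_differentiable_at f p \<Longrightarrow>
    ((\<lambda>x. frechet_derivative f (at x) v) has_derivative (\<lambda>u. second_derivative f p u v)) (at p)"
  unfolding twice_differentiable_at_def second_derivative_def
  using frechet_derivative_works by metis

lemma has_derivative_transform_nhds:
  assumes "(f has_derivative f') (at p)" "\<forall>\<^sub>F x in nhds p. f x = g x"
  shows "(g has_derivative f') (at p)"
proof (rule has_derivative_transform_eventually[OF assms(1)])
  show "\<forall>\<^sub>F x in at p. f x = g x"
    using assms(2) by (auto simp: eventually_at_filter elim: eventually_mono)
  show "f p = g p" using assms(2) by (rule eventually_nhds_x_imp_x)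
qed simp

lemma bounded_linear_second_derivative:
  "twice_differentiable_at f p \<Longrightarrow> bounded_linear (\<lambda>u. second_derivative f p u v)"
  by (rule has_derivative_bounded_linear[OF has_derivative_frechet_derivative])

text \<open>The slot \<open>v\<close> of the inner derivative: near \<open>p\<close> the Frechet
  derivative of \<open>f\<close> is linear in the direction, so both sides are derivatives at
  \<open>p\<close> of functions that agree near \<open>p\<close>, and derivatives are
  unique.\<close>

lemma linear_second_derivative:
  assumes "twice_differentiable_at f p"
  shows "linear (second_derivative f p u)"
proof
  fix v w c
  have lin: "\<forall>\<^sub>F x in nhds p. linear (frechet_derivative f (at x))"
    using assms unfolding twice_differentiable_at_def
    by (auto elim!: eventually_mono intro: linear_frechet_derivative)
  have "((\<lambda>x. frechet_derivative f (at x) (v + w)) has_derivative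
      (\<lambda>u. second_derivative f p u v + second_derivative f p u w)) (at p)"
    by (rule has_derivative_transform_nhds[OF
          has_derivative_add[OF has_derivative_frechet_derivative has_derivative_frechet_derivative]])
       (use assms lin in \<open>auto elim!: eventually_mono simp: linear_add\<close>)
  from has_derivative_unique[OF this has_derivative_frechet_derivative[OF assms]]
  show "second_derivative f p u (v + w) = second_derivative f p u v + second_derivative f p u w"
    by metis
  have "((\<lambda>x. frechet_derivative f (at x) (c *\<^sub>R v)) has_derivative
      (\<lambda>u. c *\<^sub>R second_derivative f p u v)) (at p)"
    by (rule has_derivative_transform_nhds[OF has_derivative_scaleR_right[OF has_derivative_frechet_derivative]])
       (use assms lin in \<open>auto elim!: eventually_mono simp: linear_scale\<close>)
  from has_derivative_unique[OF this has_derivative_frechet_derivative[OF assms]]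
  show "second_derivative f p u (c *\<^sub>R v) = c *\<^sub>R second_derivative f p u v"
    by metis
qed

text \<open>The second difference is the increment over \<open>[0, t]\<close> of
  \<open>f (p + s a + t b) - f (p + s a)\<close> as a function of \<open>s\<close>. The mean value
  inequality in \<open>s\<close> reduces it to the expansion at \<open>p\<close> of the derivative
  of \<open>f\<close> in direction \<open>a\<close>; continuity of second derivatives is not
  involved.\<close>

lemma second_difference_quotient:
  assumes f: "twice_differentiable_at f p"
  shows "((\<lambda>t. (f (p + t *\<^sub>R a + t *\<^sub>R b) - f (p + t *\<^sub>R a) - f (p + t *\<^sub>R b) + f p) /\<^sub>R t\<^sup>2)
    \<longlongrightarrow> second_derivative f p b a) (at_right 0)"
  unfolding tendsto_iff dist_norm
proof (intro allI impI)
  fix e :: real assume "0 < e"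
  define C where "C = norm a + norm b + 1"
  have C: "0 < C" using norm_ge_zero[of a] norm_ge_zero[of b] by (simp add: C_def add_nonneg_pos)
  \<comment> \<open>Two remainders enter below, each at most \<open>e' * (t * C)\<close>; after
    division by \<open>t\<close> they add up to \<open>2 * e' * C = e / 2\<close>.\<close>
  define e' where "e' = e / (4 * C)"
  have e': "0 < e'" using \<open>0 < e\<close> C by (simp add: e'_def)
  define F where "F u = second_derivative f p u a" for u
  interpret F: bounded_linear F
    unfolding F_def using f by (rule bounded_linear_second_derivative)
  obtain d1 where d1: "0 < d1" "\<And>x. norm (x - p) < d1 \<Longrightarrow> f differentiable (at x)"
    using f unfolding twice_differentiable_at_def eventually_nhds_metric dist_norm by blast
  obtain d2 where d2: "0 < d2" "\<And>x. norm (x - p) < d2 \<Longrightarrow>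
      norm (frechet_derivative f (at x) a - frechet_derivative f (at p) a - F (x - p)) \<le> e' * norm (x - p)"
    using has_derivative_frechet_derivative[OF f, of a] e' unfolding has_derivative_at_alt F_def by metis
  have "\<forall>\<^sub>F t in at_right 0. 0 < t \<and> t < min d1 d2 / C"
  proof -
    have "0 < min d1 d2 / C" using d1(1) d2(1) C by simp
    then show ?thesis unfolding eventually_at_right[OF zero_less_one] by blast
  qed
  then show "\<forall>\<^sub>F t in at_right 0. norm ((f (p + t *\<^sub>R a + t *\<^sub>R b) - f (p + t *\<^sub>R a) - f (p + t *\<^sub>R b) + f p) /\<^sub>R t\<^sup>2
      - second_derivative f p b a) < e"
  proof eventually_elim
    case (elim t)
    then have t: "0 < t" "t * C < d1" "t * C < d2" using C by (auto simp: field_simps)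
    \<comment> \<open>The expected main term is subtracted, so that \<open>g'\<close> becomes a
      difference of two remainders of the expansion at \<open>p\<close>: one at
      \<open>p + s a + t b\<close>, the other at \<open>p + s a\<close>.\<close>
    define g where "g s = f (p + s *\<^sub>R a + t *\<^sub>R b) - f (p + s *\<^sub>R a) - s *\<^sub>R t *\<^sub>R F b" for s
    define g' where "g' s = frechet_derivative f (at (p + s *\<^sub>R a + t *\<^sub>R b)) a
        - frechet_derivative f (at (p + s *\<^sub>R a)) a - t *\<^sub>R F b" for s
    have small: "norm (s *\<^sub>R a + c *\<^sub>R b) \<le> t * C" if "0 \<le> s" "s \<le> t" "0 \<le> c" "c \<le> t" for s c
    proof -
      have "norm (s *\<^sub>R a + c *\<^sub>R b) \<le> s * norm a + c * norm b"
        using norm_triangle_ineq[of "s *\<^sub>R a" "c *\<^sub>R b"] that by simp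
      also have "\<dots> \<le> t * norm a + t * norm b"
        using that by (intro add_mono mult_right_mono) auto
      also have "\<dots> \<le> t * C" using t(1) by (simp add: C_def algebra_simps)
      finally show ?thesis .
    qed
    have small': "norm (p + s *\<^sub>R a + c *\<^sub>R b - p) \<le> t * C" if "0 \<le> s" "s \<le> t" "0 \<le> c" "c \<le> t" for s c
      using small[OF that] by (simp add: algebra_simps)
    have expand: "norm (frechet_derivative f (at (p + s *\<^sub>R a + c *\<^sub>R b)) a - frechet_derivative f (at p) a
        - F (s *\<^sub>R a + c *\<^sub>R b)) \<le> e' * (t * C)" if "0 \<le> s" "s \<le> t" "0 \<le> c" "c \<le> t" for s c
    proof -
      have "norm (frechet_derivative f (at (p + s *\<^sub>R a + c *\<^sub>R b)) a - frechet_derivative f (at p) a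
        - F (s *\<^sub>R a + c *\<^sub>R b)) \<le> e' * norm (s *\<^sub>R a + c *\<^sub>R b)"
        using d2(2)[of "p + s *\<^sub>R a + c *\<^sub>R b"] small'[OF that] t by (simp add: algebra_simps)
      also have "\<dots> \<le> e' * (t * C)" using small[OF that] e' by (intro mult_left_mono) auto
      finally show ?thesis .
    qed
    have line: "((\<lambda>s. f (p + s *\<^sub>R a + c *\<^sub>R b)) has_derivative
        (\<lambda>h. h *\<^sub>R frechet_derivative f (at (p + s *\<^sub>R a + c *\<^sub>R b)) a)) (at s within {0..t})"
      if "s \<in> {0..t}" "0 \<le> c" "c \<le> t" for s c
    proof -
      have df: "f differentiable (at (p + s *\<^sub>R a + c *\<^sub>R b))"
        using d1(2)[of "p + s *\<^sub>R a + c *\<^sub>R b"] small'[of s c] that t by auto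
      have "((\<lambda>s. p + s *\<^sub>R a + c *\<^sub>R b) has_derivative (\<lambda>h. h *\<^sub>R a)) (at s within {0..t})"
        by (auto intro!: derivative_eq_intros)
      from has_derivative_compose[OF this df[unfolded frechet_derivative_works]]
      show ?thesis
        by (simp add: linear_scale[OF linear_frechet_derivative[OF df]])
    qed
    have "norm (g t - g 0) \<le> (2 * e' * t * C) * norm (t - 0)"
    proof (rule differentiable_bound[of "{0..t}" g "\<lambda>s h. h *\<^sub>R g' s"])
      fix s assume s: "s \<in> {0..t}"
      show "(g has_derivative (\<lambda>h. h *\<^sub>R g' s)) (at s within {0..t})"
        unfolding g_def g'_def
        using line[OF s, of t] line[OF s, of 0] t(1)
        by (auto intro!: derivative_eq_intros simp: algebra_simps)
      have "g' s = (frechet_derivative f (at (p + s *\<^sub>R a + t *\<^sub>R b)) a - frechet_derivative f (at p) a - F (s *\<^sub>R a + t *\<^sub>R b))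
          - (frechet_derivative f (at (p + s *\<^sub>R a + 0 *\<^sub>R b)) a - frechet_derivative f (at p) a - F (s *\<^sub>R a + 0 *\<^sub>R b))"
        by (simp add: g'_def F.add F.scaleR)
      then have "norm (g' s) \<le> e' * (t * C) + e' * (t * C)"
        using norm_triangle_ineq4 expand[of s t] expand[of s 0] s t(1)
        by (smt (verit, ccfv_SIG) atLeastAtMost_iff)
      moreover have "onorm (\<lambda>h::real. h *\<^sub>R g' s) \<le> norm (g' s)"
        by (rule onorm_le) (simp add: mult.commute)
      ultimately show "onorm (\<lambda>h::real. h *\<^sub>R g' s) \<le> 2 * e' * t * C" by (simp add: mult_ac)
    qed (use t(1) in auto)
    moreover have "g t - g 0 = f (p + t *\<^sub>R a + t *\<^sub>R b) - f (p + t *\<^sub>R a) - f (p + t *\<^sub>R b) + f p - t\<^sup>2 *\<^sub>R F b"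
      by (simp add: g_def power2_eq_square)
    moreover define S where "S = f (p + t *\<^sub>R a + t *\<^sub>R b) - f (p + t *\<^sub>R a) - f (p + t *\<^sub>R b) + f p"
    ultimately have "norm (S - t\<^sup>2 *\<^sub>R F b) \<le> 2 * e' * C * t\<^sup>2"
      using t(1) by (simp add: power2_eq_square mult_ac)
    moreover have "S /\<^sub>R t\<^sup>2 - F b = (S - t\<^sup>2 *\<^sub>R F b) /\<^sub>R t\<^sup>2"
      using t(1) by (simp add: algebra_simps)
    ultimately have "norm (S /\<^sub>R t\<^sup>2 - F b) \<le> inverse (t\<^sup>2) * (2 * e' * C * t\<^sup>2)"
      by (simp add: mult_left_mono)
    also have "\<dots> = 2 * e' * C" using t(1) by simp
    also have "\<dots> < e" using C \<open>0 < e\<close> by (simp add: e'_def)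
    finally show ?case by (simp add: S_def F_def)
  qed
qed

text \<open>The second difference is symmetric in \<open>a\<close> and \<open>b\<close>, and both
  mixed derivatives are its limit.\<close>

theorem second_derivative_sym:
  assumes "twice_differentiable_at f p"
  shows "second_derivative f p a b = second_derivative f p b a"
  using second_difference_quotient[OF assms, of a b] second_difference_quotient[OF assms, of b a]
  by (intro tendsto_unique[OF trivial_limit_at_right_real]) (auto simp: algebra_simps)

text \<open>Makes the expansion of the derivative uniform in the direction \<open>h\<close>: it
  holds on the finitely many basis vectors simultaneously, and the remainder is linear in
  \<open>h\<close>.\<close>

lemma frechet_derivative_expansion:
  fixes f :: "'a::euclidean_space \<Rightarrow> 'b::real_normed_vector"
  assumes f: "twice_differentiable_at f p" and "0 < e"
  obtains d where "0 < d" "\<And>x. norm (x - p) < d \<Longrightarrow> f differentiable (at x)"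
    "\<And>x h. norm (x - p) < d \<Longrightarrow>
       norm (frechet_derivative f (at x) h - frechet_derivative f (at p) h - second_derivative f p (x - p) h)
         \<le> e * norm (x - p) * norm h"
proof -
  \<comment> \<open>A sum over the basis is estimated termwise with
    \<open>\<bar>h \<bullet> b\<bar> \<le> norm h\<close>, which costs a factor
    \<open>DIM('a)\<close>.\<close>
  define e' where "e' = e / DIM('a)"
  have e': "0 < e'" using \<open>0 < e\<close> by (simp add: e'_def)
  define R where "R x h = frechet_derivative f (at x) h - frechet_derivative f (at p) h
    - second_derivative f p (x - p) h" for x h
  have "\<forall>\<^sub>F x in nhds p. norm (R x b) \<le> e' * norm (x - p)" for b
    using has_derivative_frechet_derivative[OF f, of b] e'
    unfolding has_derivative_at_alt eventually_nhds_metric dist_norm R_def by blast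
  then have "\<forall>\<^sub>F x in nhds p. \<forall>b\<in>Basis. norm (R x b) \<le> e' * norm (x - p)"
    by (simp add: eventually_ball_finite)
  moreover have "\<forall>\<^sub>F x in nhds p. f differentiable (at x)"
    using f by (simp add: twice_differentiable_at_def)
  ultimately have "\<forall>\<^sub>F x in nhds p. f differentiable (at x) \<and> (\<forall>b\<in>Basis. norm (R x b) \<le> e' * norm (x - p))"
    by eventually_elim simp
  then obtain d where d: "0 < d" "\<And>x. norm (x - p) < d \<Longrightarrow> f differentiable (at x)"
    "\<And>x b. norm (x - p) < d \<Longrightarrow> b \<in> Basis \<Longrightarrow> norm (R x b) \<le> e' * norm (x - p)"
    unfolding eventually_nhds_metric dist_norm by blast
  have "norm (R x h) \<le> e * norm (x - p) * norm h" if x: "norm (x - p) < d" for x h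
  proof -
    have lin: "linear (R x)"
      unfolding R_def
      by (intro linear_compose_sub linear_frechet_derivative linear_second_derivative
            f d(2)[OF x] twice_differentiable_at_imp_differentiable[OF f])
    have "R x h = R x (\<Sum>b\<in>Basis. (h \<bullet> b) *\<^sub>R b)" by (simp add: euclidean_representation)
    also have "\<dots> = (\<Sum>b\<in>Basis. (h \<bullet> b) *\<^sub>R R x b)"
      by (simp add: linear_sum[OF lin] linear_scale[OF lin])
    finally have "norm (R x h) \<le> (\<Sum>b\<in>Basis. \<bar>h \<bullet> b\<bar> * norm (R x b))"
      using norm_sum[of "\<lambda>b. (h \<bullet> b) *\<^sub>R R x b" Basis] by simp
    also have "\<dots> \<le> (\<Sum>b\<in>(Basis::'a set). norm h * (e' * norm (x - p)))"
      using d(3)[OF x] by (intro sum_mono mult_mono) (auto simp: Basis_le_norm)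
    also have "\<dots> = e * norm (x - p) * norm h" by (simp add: e'_def)
    finally show ?thesis .
  qed
  with d show thesis unfolding R_def by (intro that[of d]) auto
qed

text \<open>Taylor's formula along varying directions. Criticality of \<open>p\<close> is essential:
  a first-order term \<open>t n\<close> times the derivative at \<open>h n\<close> would not be
  controlled after division by the square of \<open>t n\<close>.\<close>

lemma second_order_sequential_quotient:
  fixes f :: "'a::euclidean_space \<Rightarrow> 'b::real_normed_vector"
  assumes f: "twice_differentiable_at f p" and crit: "frechet_derivative f (at p) = (\<lambda>_. 0)"
    and "\<And>n. 0 < t n" "t \<longlonglongrightarrow> 0" "h \<longlonglongrightarrow> v"
  shows "(\<lambda>n. (f (p + t n *\<^sub>R h n) - f p) /\<^sub>R (t n)\<^sup>2) \<longlonglongrightarrow> second_derivative f p v v /\<^sub>R 2"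
proof -
  define q where "q n = (f (p + t n *\<^sub>R h n) - f p) /\<^sub>R (t n)\<^sup>2" for n
  define B where "B = second_derivative f p"
  have Bl: "bounded_linear (\<lambda>u. B u w)" for w
    unfolding B_def using f by (rule bounded_linear_second_derivative)
  have Br: "linear (B u)" for u
    unfolding B_def using f by (rule linear_second_derivative)
  have Bs: "B (c *\<^sub>R u) w = c *\<^sub>R B u w" for c u w
    using linear_scale[OF bounded_linear.linear[OF Bl]] .
  have th0: "(\<lambda>n. t n *\<^sub>R h n) \<longlonglongrightarrow> 0"
    using tendsto_scaleR[OF assms(4,5)] by simp
  have hb: "\<forall>\<^sub>F n in sequentially. norm (h n) < norm v + 1"
    using order_tendstoD(2)[OF tendsto_norm[OF assms(5)]] by simp
  have "(\<lambda>n. q n - B (h n) (h n) /\<^sub>R 2) \<longlonglongrightarrow> 0"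
    unfolding tendsto_iff dist_norm
  proof (intro allI impI)
    fix e :: real assume "0 < e"
    define C where "C = (norm v + 1)\<^sup>2"
    have C: "0 < C" using norm_ge_zero[of v] unfolding C_def by (intro zero_less_power) linarith
    \<comment> \<open>\<open>C\<close> eventually bounds the square of \<open>norm (h n)\<close>, so
      the final error is at most \<open>e' * C = e / 2\<close>.\<close>
    define e' where "e' = e / (2 * C)"
    have e': "0 < e'" using \<open>0 < e\<close> C by (simp add: e'_def)
    obtain d where d: "0 < d" "\<And>x. norm (x - p) < d \<Longrightarrow> f differentiable (at x)"
      "\<And>x h. norm (x - p) < d \<Longrightarrow>
         norm (frechet_derivative f (at x) h - B (x - p) h) \<le> e' * norm (x - p) * norm h"
      using frechet_derivative_expansion[OF f e'] crit unfolding B_def by (metis diff_zero)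
    have "\<forall>\<^sub>F n in sequentially. norm (t n *\<^sub>R h n) < d"
      using order_tendstoD(2)[OF tendsto_norm[OF th0]] d(1) by simp
    then show "\<forall>\<^sub>F n in sequentially. norm (q n - B (h n) (h n) /\<^sub>R 2 - 0) < e"
      using hb
    proof eventually_elim
      case (elim n)
      define k where "k = t n *\<^sub>R h n"
      have k: "norm k < d" using elim by (simp add: k_def)
      \<comment> \<open>The quadratic Taylor term is removed on the segment from \<open>p\<close> to
        \<open>p + k\<close>. Then \<open>g'\<close> is the remainder in the expansion of the
        derivative, and the mean value inequality bounds \<open>g 1 - g 0\<close>.\<close>
      define g where "g s = f (p + s *\<^sub>R k) - (s\<^sup>2 / 2) *\<^sub>R B k k" for s
      define g' where "g' s = frechet_derivative f (at (p + s *\<^sub>R k)) k - s *\<^sub>R B k k" for s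
      have "norm (g 1 - g 0) \<le> (e' * (norm k)\<^sup>2) * norm (1 - 0 :: real)"
      proof (rule differentiable_bound[of "{0..1}" g "\<lambda>s h. h *\<^sub>R g' s"])
        fix s :: real assume s: "s \<in> {0..1}"
        have sk: "norm (s *\<^sub>R k) \<le> norm k"
          using s mult_right_mono[of s 1 "norm k"] by simp
        have df: "f differentiable (at (p + s *\<^sub>R k))"
          using d(2)[of "p + s *\<^sub>R k"] sk k by simp
        have "((\<lambda>s. p + s *\<^sub>R k) has_derivative (\<lambda>h. h *\<^sub>R k)) (at s within {0..1})"
          by (auto intro!: derivative_eq_intros)
        from has_derivative_compose[OF this df[unfolded frechet_derivative_works]]
        have "((\<lambda>s. f (p + s *\<^sub>R k)) has_derivative (\<lambda>h. h *\<^sub>R frechet_derivative f (at (p + s *\<^sub>R k)) k)) (at s within {0..1})"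
          by (simp add: linear_scale[OF linear_frechet_derivative[OF df]])
        then show "(g has_derivative (\<lambda>h. h *\<^sub>R g' s)) (at s within {0..1})"
          unfolding g_def g'_def
          by (auto intro!: derivative_eq_intros simp: algebra_simps)
        have "g' s = frechet_derivative f (at (p + s *\<^sub>R k)) k - B (s *\<^sub>R k) k"
          by (simp add: g'_def Bs)
        then have "norm (g' s) \<le> e' * norm (s *\<^sub>R k) * norm k"
          using d(3)[of "p + s *\<^sub>R k" k] sk k by simp
        also have "\<dots> \<le> e' * norm k * norm k"
          using sk e' by (intro mult_right_mono mult_left_mono) auto
        finally have "norm (g' s) \<le> e' * (norm k)\<^sup>2" by (simp add: power2_eq_square mult.assoc)
        moreover have "onorm (\<lambda>h::real. h *\<^sub>R g' s) \<le> norm (g' s)"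
          by (rule onorm_le) (simp add: mult.commute)
        ultimately show "onorm (\<lambda>h::real. h *\<^sub>R g' s) \<le> e' * (norm k)\<^sup>2" by simp
      qed auto
      moreover have "B k k = (t n)\<^sup>2 *\<^sub>R B (h n) (h n)"
        by (simp add: k_def Bs linear_scale[OF Br] power2_eq_square)
      moreover have "(norm k)\<^sup>2 = (t n)\<^sup>2 * (norm (h n))\<^sup>2"
        by (simp add: k_def power_mult_distrib)
      ultimately have bd: "norm (f (p + k) - f p - ((t n)\<^sup>2 / 2) *\<^sub>R B (h n) (h n)) \<le> (e' * (norm (h n))\<^sup>2) * (t n)\<^sup>2"
        by (simp add: g_def mult_ac algebra_simps)
      have "q n - B (h n) (h n) /\<^sub>R 2 = (f (p + k) - f p - ((t n)\<^sup>2 / 2) *\<^sub>R B (h n) (h n)) /\<^sub>R (t n)\<^sup>2"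
        using assms(3)[of n] by (simp add: q_def k_def scaleR_diff_right)
      then have "norm (q n - B (h n) (h n) /\<^sub>R 2) \<le> e' * (norm (h n))\<^sup>2"
        using bd assms(3)[of n] by (simp add: divide_simps)
      also have "\<dots> \<le> e' * C"
        unfolding C_def using e' elim(2) by (intro mult_left_mono power_mono) auto
      also have "\<dots> < e" using C \<open>0 < e\<close> by (simp add: e'_def)
      finally show ?case by simp
    qed
  qed
  moreover have "(\<lambda>n. B (h n) (h n)) \<longlonglongrightarrow> B v v"
  proof -
    \<comment> \<open>Joint convergence of \<open>B (h n) (h n)\<close>: expanding the second
      argument in the basis leaves only continuity of \<open>B\<close> in the first one.\<close>
    have rep: "(\<Sum>b\<in>Basis. (w \<bullet> b) *\<^sub>R B u b) = B u w" for u w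
    proof -
      have "B u w = B u (\<Sum>b\<in>Basis. (w \<bullet> b) *\<^sub>R b)" by (simp add: euclidean_representation)
      then show ?thesis by (simp only: linear_sum[OF Br] linear_scale[OF Br])
    qed
    have "(\<lambda>n. \<Sum>b\<in>Basis. (h n \<bullet> b) *\<^sub>R B (h n) b) \<longlonglongrightarrow> (\<Sum>b\<in>Basis. (v \<bullet> b) *\<^sub>R B v b)"
      by (intro tendsto_sum tendsto_scaleR tendsto_inner tendsto_const bounded_linear.tendsto[OF Bl] assms(5))
    then show ?thesis by (simp only: rep)
  qed
  ultimately have "(\<lambda>n. (q n - B (h n) (h n) /\<^sub>R 2) + B (h n) (h n) /\<^sub>R 2) \<longlonglongrightarrow> 0 + B v v /\<^sub>R 2"
    by (intro tendsto_add tendsto_scaleR tendsto_const)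
  then show ?thesis by (simp add: q_def B_def)
qed

text \<open>The second-order analogue of \<open>derivative_in_closed_cone\<close>: the quotients by
  the square of \<open>t n\<close> lie in \<open>K\<close>, and the cone property absorbs the factor
  1/2.\<close>

lemma second_derivative_in_closed_cone:
  fixes f :: "'a::euclidean_space \<Rightarrow> 'b::real_normed_vector"
  assumes "twice_differentiable_at f p" "frechet_derivative f (at p) = (\<lambda>_. 0)"
    "v \<in> contingent_cone S p" "open U" "p \<in> U" "f p = 0"
    "closed K" "cone K" "\<And>x. x \<in> S \<inter> U \<Longrightarrow> f x \<in> K"
  shows "second_derivative f p v v \<in> K"
proof -
  obtain t h where th: "\<And>n. 0 < t n" "t \<longlonglongrightarrow> 0" "h \<longlonglongrightarrow> v"
    "\<forall>\<^sub>F n in sequentially. p + t n *\<^sub>R h n \<in> S \<inter> U"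
    using contingent_coneE[OF assms(3-5)] by blast
  have "\<forall>\<^sub>F n in sequentially. (f (p + t n *\<^sub>R h n) - f p) /\<^sub>R (t n)\<^sup>2 \<in> K"
    using th(4)
  proof eventually_elim
    case (elim n)
    show ?case using mem_cone[OF assms(8) assms(9)[OF elim], of "inverse ((t n)\<^sup>2)"] assms(6) by simp
  qed
  from Lim_in_closed_set[OF assms(7) this trivial_limit_sequentially
      second_order_sequential_quotient[OF assms(1,2) th(1-3)]]
  have "second_derivative f p v v /\<^sub>R 2 \<in> K" .
  from mem_cone[OF assms(8) this, of 2] show ?thesis by simp
qed

section \<open>Closure properties of smoothness, and Wirtinger operators written with the real
  directions z and iz\<close>

section \<open>Smooth functions and Wirtinger calculus\<close>

lemma Ck_on_cong:
  assumes "open U" "\<And>x. x \<in> U \<Longrightarrow> f x = g x" "Ck_on k f U"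
  shows "Ck_on k g U"
  using assms(2,3)
proof (induction k arbitrary: f g)
  case 0
  then show ?case using continuous_on_cong by (metis Ck_on.simps(1))
next
  case (Suc k)
  have f: "f differentiable (at x)" if "x \<in> U" for x using Suc.prems(2) that by simp
  have eq: "frechet_derivative f (at x) = frechet_derivative g (at x)" if "x \<in> U" for x
    using f[OF that] assms(1) that Suc.prems(1) by (rule frechet_derivative_transform_within_open)
  have "g differentiable (at x)" if "x \<in> U" for x
    using has_derivative_transform_within_open[OF f[OF that, unfolded frechet_derivative_works] assms(1) that]
      Suc.prems(1) by (auto simp: differentiable_def)
  moreover have "Ck_on k (\<lambda>x. frechet_derivative g (at x) v) U" for v
    by (rule Suc.IH[of "\<lambda>x. frechet_derivative f (at x) v"]) (use eq Suc.prems(2) in auto)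
  ultimately show ?case by simp
qed

lemma Ck_on_bounded_linear:
  assumes "bounded_linear h" "open U" "Ck_on k f U"
  shows "Ck_on k (\<lambda>x. h (f x)) U"
  using assms(3)
proof (induction k arbitrary: f)
  case 0
  then show ?case using bounded_linear.continuous_on[OF assms(1)] by simp
next
  case (Suc k)
  have der: "((\<lambda>x. h (f x)) has_derivative (\<lambda>v. h (frechet_derivative f (at x) v))) (at x)" if "x \<in> U" for x
    using Suc.prems that bounded_linear.has_derivative[OF assms(1)] frechet_derivative_works[of f "at x"] by auto
  have "Ck_on k (\<lambda>x. frechet_derivative (\<lambda>x. h (f x)) (at x) v) U" for v
  proof (rule Ck_on_cong[OF assms(2)])
    show "Ck_on k (\<lambda>x. h (frechet_derivative f (at x) v)) U"
      using Suc.prems by (intro Suc.IH) simp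
    show "h (frechet_derivative f (at x) v) = frechet_derivative (\<lambda>x. h (f x)) (at x) v" if "x \<in> U" for x
      using frechet_derivative_at[OF der[OF that]] by (rule fun_cong)
  qed
  then show ?case using der by (auto simp: differentiable_def)
qed

lemma Ck_on_diff:
  assumes "open U" "Ck_on k f U" "Ck_on k g U"
  shows "Ck_on k (\<lambda>x. f x - g x) U"
  using assms(2,3)
proof (induction k arbitrary: f g)
  case 0
  then show ?case by (simp add: continuous_on_diff)
next
  case (Suc k)
  have der: "((\<lambda>x. f x - g x) has_derivative
      (\<lambda>v. frechet_derivative f (at x) v - frechet_derivative g (at x) v)) (at x)" if "x \<in> U" for x
    using Suc.prems that by (intro has_derivative_diff) (auto simp: frechet_derivative_works[symmetric])
  have "Ck_on k (\<lambda>x. frechet_derivative (\<lambda>x. f x - g x) (at x) v) U" for v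
  proof (rule Ck_on_cong[OF assms(1)])
    show "Ck_on k (\<lambda>x. frechet_derivative f (at x) v - frechet_derivative g (at x) v) U"
      using Suc.prems by (intro Suc.IH) simp_all
    show "frechet_derivative f (at x) v - frechet_derivative g (at x) v
        = frechet_derivative (\<lambda>x. f x - g x) (at x) v" if "x \<in> U" for x
      using frechet_derivative_at[OF der[OF that]] by (rule fun_cong)
  qed
  then show ?case using der by (auto simp: differentiable_def)
qed

lemma Ck_on_subset: "Ck_on k f U \<Longrightarrow> V \<subseteq> U \<Longrightarrow> Ck_on k f V"
  by (induction k arbitrary: f) (auto intro: continuous_on_subset)

lemma smooth_on_subset: "smooth_on U f \<Longrightarrow> V \<subseteq> U \<Longrightarrow> smooth_on V f"
  unfolding smooth_on_def by (blast intro: Ck_on_subset)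

lemma smooth_on_bounded_linear:
  "bounded_linear h \<Longrightarrow> open U \<Longrightarrow> smooth_on U f \<Longrightarrow> smooth_on U (\<lambda>x. h (f x))"
  unfolding smooth_on_def by (blast intro: Ck_on_bounded_linear)

lemma smooth_on_diff:
  "open U \<Longrightarrow> smooth_on U f \<Longrightarrow> smooth_on U g \<Longrightarrow> smooth_on U (\<lambda>x. f x - g x)"
  unfolding smooth_on_def by (blast intro: Ck_on_diff)

lemma smooth_on_imp_continuous_on: "smooth_on U f \<Longrightarrow> continuous_on U f"
  unfolding smooth_on_def by (metis Ck_on.simps(1))

lemma smooth_on_imp_differentiable: "smooth_on U f \<Longrightarrow> x \<in> U \<Longrightarrow> f differentiable (at x)"
  unfolding smooth_on_def by (metis Ck_on.simps(2))

lemma smooth_on_frechet_derivative: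
  "smooth_on U f \<Longrightarrow> smooth_on U (\<lambda>x. frechet_derivative f (at x) v)"
  unfolding smooth_on_def by (metis Ck_on.simps(2))

lemma smooth_on_second_derivative: "smooth_on U f \<Longrightarrow> smooth_on U (\<lambda>x. second_derivative f x u v)"
  unfolding second_derivative_def by (intro smooth_on_frechet_derivative)

lemma smooth_on_imp_twice_differentiable:
  "open U \<Longrightarrow> smooth_on U f \<Longrightarrow> x \<in> U \<Longrightarrow> twice_differentiable_at f x"
  unfolding twice_differentiable_at_def eventually_nhds
  by (blast intro: smooth_on_imp_differentiable smooth_on_frechet_derivative)

lemma vec_real_expansion:
  fixes z :: "complex^2"
  shows "z = (\<Sum>j\<in>UNIV. Re (z $ j) *\<^sub>R axis j 1 + Im (z $ j) *\<^sub>R axis j \<i>)"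
  by (simp add: vec_eq_iff sum_2 forall_2 axis_def complex_eq_iff)

lemma ii_mult_vec_expansion:
  fixes z :: "complex^2"
  shows "\<i> *s z = (\<Sum>j\<in>UNIV. Re (z $ j) *\<^sub>R axis j \<i> - Im (z $ j) *\<^sub>R axis j 1)"
  by (simp add: vec_eq_iff sum_2 forall_2 axis_def complex_eq_iff)

text \<open>A real-linear \<open>G\<close> is the sum of a complex-linear and an antilinear part;
  both sides are these parts evaluated at \<open>z\<close>. Coordinate sums thus turn into values at
  the two real directions \<open>z\<close> and \<open>\<i> *s z\<close>.\<close>

lemma linear_type_10_sum:
  fixes G :: "complex^2 \<Rightarrow> complex"
  assumes "linear G"
  shows "(\<Sum>j\<in>UNIV. z $ j * ((G (axis j 1) - \<i> * G (axis j \<i>)) / 2)) = (G z - \<i> * G (\<i> *s z)) / 2"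
    and "(\<Sum>j\<in>UNIV. cnj (z $ j) * ((G (axis j 1) + \<i> * G (axis j \<i>)) / 2)) = (G z + \<i> * G (\<i> *s z)) / 2"
proof -
  have 1: "G z = (\<Sum>j\<in>UNIV. Re (z $ j) *\<^sub>R G (axis j 1) + Im (z $ j) *\<^sub>R G (axis j \<i>))"
    by (subst vec_real_expansion) (simp only: linear_sum[OF assms] linear_add[OF assms] linear_scale[OF assms])
  have 2: "G (\<i> *s z) = (\<Sum>j\<in>UNIV. Re (z $ j) *\<^sub>R G (axis j \<i>) - Im (z $ j) *\<^sub>R G (axis j 1))"
    by (subst ii_mult_vec_expansion) (simp only: linear_sum[OF assms] linear_diff[OF assms] linear_scale[OF assms])
  show "(\<Sum>j\<in>UNIV. z $ j * ((G (axis j 1) - \<i> * G (axis j \<i>)) / 2)) = (G z - \<i> * G (\<i> *s z)) / 2"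
    "(\<Sum>j\<in>UNIV. cnj (z $ j) * ((G (axis j 1) + \<i> * G (axis j \<i>)) / 2)) = (G z + \<i> * G (\<i> *s z)) / 2"
    unfolding 1 2 by (simp_all add: sum_2 complex_eq_iff field_simps)
qed

lemma has_derivative_vf:
  assumes "(f has_derivative f') (at p)"
  shows "vf L f p = (f' (L p) - \<i> * f' (\<i> *s L p)) / 2"
    and "vf_bar L f p = (f' (L p) + \<i> * f' (\<i> *s L p)) / 2"
  using linear_type_10_sum[OF has_derivative_linear[OF assms], of "L p"]
  unfolding vf_def vf_bar_def dz_def dzbar_def frechet_derivative_at[OF assms, symmetric] by auto

lemma vf_sum_mult:
  assumes "\<And>k. c k differentiable (at p)" "\<And>k. g k differentiable (at p)"
  shows "vf L (\<lambda>x. \<Sum>k\<in>(UNIV::2 set). c k x * g k x) p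
    = (\<Sum>k\<in>UNIV. c k p * vf L (g k) p) + (\<Sum>k\<in>UNIV. vf L (c k) p * g k p)"
proof -
  note c = assms(1)[unfolded frechet_derivative_works] and g = assms(2)[unfolded frechet_derivative_works]
  have sum': "((\<lambda>x. \<Sum>k\<in>(UNIV::2 set). c k x * g k x) has_derivative
      (\<lambda>u. \<Sum>k\<in>UNIV. c k p * frechet_derivative (g k) (at p) u + frechet_derivative (c k) (at p) u * g k p)) (at p)"
    by (intro has_derivative_sum has_derivative_mult c g)
  show ?thesis
    unfolding has_derivative_vf(1)[OF sum', of L] has_derivative_vf(1)[OF c, of L] has_derivative_vf(1)[OF g, of L]
    by (simp add: sum_2 field_simps)
qed

lemma has_derivative_dz:
  assumes "twice_differentiable_at f p"
  shows "(dz k f has_derivative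
      (\<lambda>u. (second_derivative f p u (axis k 1) - \<i> * second_derivative f p u (axis k \<i>)) / 2)) (at p)"
    and "(dzbar k f has_derivative
      (\<lambda>u. (second_derivative f p u (axis k 1) + \<i> * second_derivative f p u (axis k \<i>)) / 2)) (at p)"
  unfolding dz_def[abs_def] dzbar_def[abs_def]
  by (auto intro!: derivative_eq_intros has_derivative_frechet_derivative assms)

lemma linear_sesqui_combination:
  assumes "twice_differentiable_at f p"
  shows "linear (\<lambda>w. (second_derivative f p u w - \<i> * second_derivative f p v w) / (2::complex))"
  by (rule linearI)
     (simp_all add: linear_add[OF linear_second_derivative[OF assms]]
        linear_scale[OF linear_second_derivative[OF assms]] field_simps scaleR_conv_of_real)

lemma hess_form_eq_sum: "hess_form f A B p = (\<Sum>k\<in>UNIV. cnj (B p $ k) * vf A (dzbar k f) p)"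
  unfolding hess_form_def vf_def by (simp add: sum_2 algebra_simps)

text \<open>The complex Hessian is the part of the real one that is complex-linear in the slot of
  \<open>A\<close> and antilinear in the slot of \<open>B\<close>.\<close>

lemma hess_form_eq:
  fixes A B :: "complex^2 \<Rightarrow> complex^2"
  assumes "twice_differentiable_at f p"
  defines "D \<equiv> second_derivative f p" and "a \<equiv> A p" and "b \<equiv> B p"
  shows "hess_form f A B p = (D a b + D (\<i> *s a) (\<i> *s b) + \<i> * (D a (\<i> *s b) - D (\<i> *s a) b)) / 4"
proof -
  \<comment> \<open>The complex-linear part in the first slot, taken at \<open>a\<close>, as a
    function of the second slot.\<close>
  define G where "G w = (D a w - \<i> * D (\<i> *s a) w) / 2" for w
  have "linear G" unfolding G_def D_def using assms(1) by (rule linear_sesqui_combination)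
  have "hess_form f A B p = (\<Sum>k\<in>UNIV. cnj (b $ k) * ((G (axis k 1) + \<i> * G (axis k \<i>)) / 2))"
    unfolding hess_form_eq_sum has_derivative_vf(1)[OF has_derivative_dz(2)[OF assms(1)]] G_def
    by (simp add: D_def a_def b_def field_simps)
  also have "\<dots> = (G b + \<i> * G (\<i> *s b)) / 2"
    by (rule linear_type_10_sum(2)[OF \<open>linear G\<close>])
  also have "\<dots> = (D a b + D (\<i> *s a) (\<i> *s b) + \<i> * (D a (\<i> *s b) - D (\<i> *s a) b)) / 4"
    by (simp add: G_def field_simps)
  finally show ?thesis .
qed

text \<open>Product rule: \<open>A\<close> either differentiates \<open>dzbar k f\<close>, which
  gives the Hessian, or the coefficients of the conjugate of \<open>B\<close>, which leaves only
  first derivatives of \<open>f\<close>.\<close>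

lemma vf_vf_bar:
  assumes "twice_differentiable_at f p" "\<And>k. (\<lambda>x. B x $ k) differentiable (at p)"
  shows "vf A (vf_bar B f) p = hess_form f A B p + (\<Sum>k\<in>UNIV. vf A (\<lambda>x. cnj (B x $ k)) p * dzbar k f p)"
proof -
  have "(\<lambda>x. cnj (B x $ k)) differentiable (at p)" for k
    using assms(2)[of k] bounded_linear.has_derivative[OF bounded_linear_cnj]
    unfolding differentiable_def by blast
  moreover have "dzbar k f differentiable (at p)" for k
    using has_derivative_dz(2)[OF assms(1)] unfolding differentiable_def by blast
  ultimately show ?thesis
    unfolding vf_bar_def[abs_def] hess_form_eq_sum by (rule vf_sum_mult)
qed

text \<open>The same product rule for type (1,0) twice; the terms in which the coefficients of
  \<open>B\<close> are differentiated carry a factor \<open>dz k f p = 0\<close>.\<close>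

lemma vf_vf_critical:
  fixes A B :: "complex^2 \<Rightarrow> complex^2"
  assumes f: "twice_differentiable_at f p" and "\<And>k. (\<lambda>x. B x $ k) differentiable (at p)"
    and crit: "frechet_derivative f (at p) = (\<lambda>_. 0)"
  defines "D \<equiv> second_derivative f p" and "a \<equiv> A p" and "b \<equiv> B p"
  shows "vf A (vf B f) p = (D a b - D (\<i> *s a) (\<i> *s b) - \<i> * (D a (\<i> *s b) + D (\<i> *s a) b)) / 4"
proof -
  have "dz k f differentiable (at p)" for k
    using has_derivative_dz(1)[OF f] unfolding differentiable_def by blast
  with assms(2) have "vf A (vf B f) p
      = (\<Sum>k\<in>UNIV. B p $ k * vf A (dz k f) p) + (\<Sum>k\<in>UNIV. vf A (\<lambda>x. B x $ k) p * dz k f p)"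
    unfolding vf_def[of B, abs_def] by (rule vf_sum_mult)
  also have "\<dots> = (\<Sum>k\<in>UNIV. B p $ k * vf A (dz k f) p)"
    by (simp add: dz_def crit)
  finally have *: "vf A (vf B f) p = (\<Sum>k\<in>UNIV. B p $ k * vf A (dz k f) p)" .
  define G where "G w = (D a w - \<i> * D (\<i> *s a) w) / 2" for w
  have "linear G" unfolding G_def D_def using f by (rule linear_sesqui_combination)
  have "vf A (vf B f) p = (\<Sum>k\<in>UNIV. b $ k * ((G (axis k 1) - \<i> * G (axis k \<i>)) / 2))"
    unfolding * has_derivative_vf(1)[OF has_derivative_dz(1)[OF f]] G_def
    by (simp add: D_def a_def b_def field_simps)
  also have "\<dots> = (G b - \<i> * G (\<i> *s b)) / 2"
    by (rule linear_type_10_sum(1)[OF \<open>linear G\<close>])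
  also have "\<dots> = (D a b - D (\<i> *s a) (\<i> *s b) - \<i> * (D a (\<i> *s b) + D (\<i> *s a) b)) / 4"
    by (simp add: G_def field_simps)
  finally show ?thesis .
qed

lemma continuous_on_hess_form:
  assumes "open U" "smooth_on U f" "hol_vector_field U A" "hol_vector_field U B"
  shows "continuous_on U (hess_form f A B)"
proof -
  have "continuous_on U (\<lambda>x. dz j (dzbar k f) x)" for j k
  proof -
    have "continuous_on U (\<lambda>x. (
        (second_derivative f x (axis j 1) (axis k 1) + \<i> * second_derivative f x (axis j 1) (axis k \<i>)) / 2
        - \<i> * ((second_derivative f x (axis j \<i>) (axis k 1) + \<i> * second_derivative f x (axis j \<i>) (axis k \<i>)) / 2)) / 2)"
      by (intro continuous_intros smooth_on_imp_continuous_on smooth_on_second_derivative assms(2)) auto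
    then show ?thesis
      by (rule continuous_on_eq)
         (simp add: dz_def[of j] frechet_derivative_at[OF has_derivative_dz(2)[OF
            smooth_on_imp_twice_differentiable[OF assms(1,2)]], symmetric])
  qed
  moreover have "continuous_on U (\<lambda>x. A x $ k)" "continuous_on U (\<lambda>x. B x $ k)" for k
    using assms(3,4) smooth_on_imp_continuous_on unfolding hol_vector_field_def by blast+
  ultimately show ?thesis
    unfolding hess_form_def[abs_def] by (intro continuous_on_sum continuous_on_mult continuous_on_cnj)
qed

section \<open>Tangential differentiation depends only on boundary values\<close>

section \<open>Tangential derivatives\<close>

lemma second_derivative_bounded_linear:
  assumes h: "bounded_linear h" and f: "twice_differentiable_at f p"
  shows "second_derivative (\<lambda>x. h (f x)) p u v = h (second_derivative f p u v)"
proof -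
  have "\<forall>\<^sub>F x in nhds p. h (frechet_derivative f (at x) v) = frechet_derivative (\<lambda>x. h (f x)) (at x) v"
    using f[unfolded twice_differentiable_at_def, THEN conjunct1]
  proof eventually_elim
    case (elim x)
    show ?case
      using frechet_derivative_at[OF bounded_linear.has_derivative[OF h elim[unfolded frechet_derivative_works]]]
      by (rule fun_cong)
  qed
  from has_derivative_transform_nhds[OF bounded_linear.has_derivative[OF h has_derivative_frechet_derivative[OF f]] this]
  show ?thesis
    unfolding second_derivative_def[of "\<lambda>x. h (f x)"]
    by (simp add: frechet_derivative_at[symmetric])
qed

text \<open>For equal arguments the imaginary part in \<open>hess_form_eq\<close> is the difference
  of two mixed real derivatives, which symmetry cancels.\<close>

lemma hess_form_real:
  assumes "open U" "smooth_on U r" "p \<in> U"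
  shows "hess_form (cplx r) L L p \<in> \<real>"
proof -
  note r = smooth_on_imp_twice_differentiable[OF assms]
  have cr: "twice_differentiable_at (cplx r) p"
    using assms by (intro smooth_on_imp_twice_differentiable smooth_on_bounded_linear[OF bounded_linear_of_real])
  show ?thesis
    unfolding hess_form_eq[OF cr] second_derivative_bounded_linear[OF bounded_linear_of_real r]
    by (simp add: second_derivative_sym[OF r, of "\<i> *s L p" "L p"] Reals_add Reals_divide)
qed

text \<open>If \<open>g w \<noteq> 0\<close>, then \<open>v - (g v / g w) w\<close> lies in the
  kernel of \<open>g\<close>, hence of \<open>f\<close>. This supplies the Lagrange
  multipliers.\<close>

lemma linear_kernel_factor:
  fixes g :: "'a::real_vector \<Rightarrow> real" and f :: "'a \<Rightarrow> 'b::real_vector"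
  assumes "linear f" "linear g" "g \<noteq> (\<lambda>_. 0)" "\<And>v. g v = 0 \<Longrightarrow> f v = 0"
  shows "\<exists>c. \<forall>v. f v = g v *\<^sub>R c"
proof -
  obtain w where w: "g w \<noteq> 0" using assms(3) by blast
  have "f v = g v *\<^sub>R (f w /\<^sub>R g w)" for v
  proof -
    have "g (v - (g v / g w) *\<^sub>R w) = 0"
      using w by (simp add: linear_diff[OF assms(2)] linear_scale[OF assms(2)])
    from assms(4)[OF this] show ?thesis
      by (simp add: linear_diff[OF assms(1)] linear_scale[OF assms(1)] divide_inverse)
  qed
  then show ?thesis by blast
qed

lemma cplx_has_derivative:
  "r differentiable (at q) \<Longrightarrow> (cplx r has_derivative (\<lambda>v. complex_of_real (frechet_derivative r (at q) v))) (at q)"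
  by (rule bounded_linear.has_derivative[OF bounded_linear_of_real]) (simp add: frechet_derivative_works[symmetric])

text \<open>The real and imaginary parts of \<open>L r\<close> are, up to constants, the derivatives
  of \<open>r\<close> along \<open>L\<close> and \<open>\<i> *s L\<close>; a tangential field thus
  yields two real tangent directions.\<close>

lemma vf_cplx_eq_0_iff:
  assumes "r differentiable (at q)"
  shows "vf L (cplx r) q = 0 \<longleftrightarrow>
    frechet_derivative r (at q) (L q) = 0 \<and> frechet_derivative r (at q) (\<i> *s L q) = 0"
  unfolding has_derivative_vf(1)[OF cplx_has_derivative[OF assms]] by (auto simp: complex_eq_iff)

lemma local_defining_function_zero:
  assumes "open \<Omega>" "local_defining_function \<Omega> p U r" "q \<in> frontier \<Omega> \<inter> U"
  shows "r q = 0"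
proof (rule defining_function_zero_on_frontier[of \<Omega> q U])
  show "isCont r q"
    using assms smooth_on_imp_differentiable differentiable_imp_continuous_within
    unfolding local_defining_function_def by blast
qed (use assms in \<open>auto simp: local_defining_function_def\<close>)

lemma local_defining_function_tangent:
  assumes "open \<Omega>" "local_defining_function \<Omega> p U r" "q \<in> frontier \<Omega> \<inter> U"
    and "frechet_derivative r (at q) v = 0"
  shows "v \<in> contingent_cone (frontier \<Omega>) q"
proof (rule contingent_cone_frontier[of \<Omega> q U r])
  show "(r has_derivative frechet_derivative r (at q)) (at q)"
    using assms(2,3) smooth_on_imp_differentiable[of U r q]
    by (simp add: local_defining_function_def frechet_derivative_works)
qed (use assms in \<open>auto simp: local_defining_function_def\<close>)

text \<open>The difference \<open>f - g\<close> vanishes on the boundary near \<open>q\<close>, so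
  its derivative kills \<open>L q\<close> and \<open>\<i> *s L q\<close>, and these two values
  determine both operators.\<close>

lemma vf_eq_on_frontier:
  assumes \<Omega>: "open \<Omega>" "local_defining_function \<Omega> p U r" "q \<in> frontier \<Omega> \<inter> U"
    and L: "vf L (cplx r) q = 0"
    and fg: "f differentiable (at q)" "g differentiable (at q)"
    and V: "open V" "q \<in> V" "\<And>x. x \<in> frontier \<Omega> \<inter> V \<Longrightarrow> f x = g x"
  shows "vf L f q = vf L g q" "vf_bar L f q = vf_bar L g q"
proof -
  note f = fg(1)[unfolded frechet_derivative_works] and g = fg(2)[unfolded frechet_derivative_works]
  have "r differentiable (at q)"
    using \<Omega> smooth_on_imp_differentiable unfolding local_defining_function_def by blast
  with L have tan: "frechet_derivative r (at q) (L q) = 0" "frechet_derivative r (at q) (\<i> *s L q) = 0"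
    by (simp_all add: vf_cplx_eq_0_iff)
  have "frechet_derivative f (at q) v - frechet_derivative g (at q) v = 0"
    if "frechet_derivative r (at q) v = 0" for v
    using has_derivative_diff[OF f g] local_defining_function_tangent[OF \<Omega> that] V(1,2)
    by (rule derivative_zero_on_contingent_cone) (use \<Omega>(3) V in auto)
  with tan show "vf L f q = vf L g q" "vf_bar L f q = vf_bar L g q"
    unfolding has_derivative_vf[OF f] has_derivative_vf[OF g] by simp_all
qed

lemma vf_differentiable:
  assumes "open U" "hol_vector_field U L" "smooth_on U f" "p \<in> U"
  shows "vf L f differentiable (at p)" "vf_bar L f differentiable (at p)"
proof -
  have L: "(\<lambda>x. L x $ k) differentiable (at p)" for k
    using assms smooth_on_imp_differentiable unfolding hol_vector_field_def by blast
  then have Lc: "(\<lambda>x. cnj (L x $ k)) differentiable (at p)" for k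
    using bounded_linear.has_derivative[OF bounded_linear_cnj] unfolding differentiable_def by blast
  have d: "dz k f differentiable (at p)" "dzbar k f differentiable (at p)" for k
    using has_derivative_dz[OF smooth_on_imp_twice_differentiable[OF assms(1,3,4)]]
    unfolding differentiable_def by blast+
  show "vf L f differentiable (at p)" "vf_bar L f differentiable (at p)"
    unfolding vf_def[abs_def] vf_bar_def[abs_def] sum_2
    by (intro differentiable_add differentiable_mult L Lc d)+
qed

text \<open>The first derivatives vanish at all boundary points of \<open>V\<close>, not just at
  \<open>q\<close>; so the same argument applies again to \<open>vf_bar L f\<close>.\<close>

lemma vf_zero_on_frontier:
  assumes \<Omega>: "open \<Omega>" "local_defining_function \<Omega> p U r" "hol_vector_field U L" "tangential \<Omega> U r L"
    and V: "open V" "V \<subseteq> U" "smooth_on V f" "\<And>x. x \<in> frontier \<Omega> \<inter> V \<Longrightarrow> f x = 0"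
    and q: "q \<in> frontier \<Omega> \<inter> V"
  shows "vf L f q = 0" "vf L (vf_bar L f) q = 0"
proof -
  have tan: "vf L (cplx r) x = 0" if "x \<in> frontier \<Omega> \<inter> V" for x
    using \<Omega>(4) that V(2) by (auto simp: tangential_def)
  have z: "vf L (\<lambda>_. 0) x = 0" "vf_bar L (\<lambda>_. 0) x = 0" for x
    using has_derivative_vf[OF has_derivative_const[of 0 "at x"]] by simp_all
  have hol: "hol_vector_field V L"
    using \<Omega>(3) V(2) smooth_on_subset unfolding hol_vector_field_def by blast
  have *: "vf L f x = 0" "vf_bar L f x = 0" if x: "x \<in> frontier \<Omega> \<inter> V" for x
    using vf_eq_on_frontier[OF \<Omega>(1,2), of x L f "\<lambda>_. 0" V] x tan[OF x] V z
      smooth_on_imp_differentiable[OF V(3), of x] by auto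
  show "vf L f q = 0" using * q by auto
  show "vf L (vf_bar L f) q = 0"
    using vf_eq_on_frontier(1)[OF \<Omega>(1,2), of q L "vf_bar L f" "\<lambda>_. 0" V] q tan[OF q] V(1,2) z *
      vf_differentiable(2)[OF V(1) hol V(3), of q] by auto
qed

lemma dz_nonzero:
  assumes "r differentiable (at q)" "frechet_derivative r (at q) \<noteq> (\<lambda>_. 0)"
  shows "\<exists>j. dz j (cplx r) q \<noteq> 0"
proof (rule ccontr)
  assume "\<not> ?thesis"
  then have "vf (\<lambda>_. v) (cplx r) q = 0" for v by (simp add: vf_def)
  then show False using assms by (auto simp: vf_cplx_eq_0_iff)
qed

text \<open>Here complex dimension two enters: the annihilator of a nonzero covector is a complex
  line. Eliminating \<open>b\<close> shows that the determinant of \<open>x\<close> and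
  \<open>y\<close> vanishes.\<close>

lemma orthogonal_proportional:
  fixes x y b :: "complex^2"
  assumes "(\<Sum>j\<in>UNIV. x $ j * b $ j) = 0" "(\<Sum>j\<in>UNIV. y $ j * b $ j) = 0" "b \<noteq> 0" "y \<noteq> 0"
  shows "\<exists>c. x = c *s y"
proof -
  have eqs: "x$1 * b$1 + x$2 * b$2 = 0" "y$1 * b$1 + y$2 * b$2 = 0"
    using assms(1,2) by (simp_all add: sum_2)
  have "(x$1 * y$2 - x$2 * y$1) * b$1 = 0" "(x$1 * y$2 - x$2 * y$1) * b$2 = 0"
    using eqs by algebra+
  then have det: "x$1 * y$2 = x$2 * y$1"
    using assms(3) by (auto simp: vec_eq_iff forall_2)
  show ?thesis
  proof (cases "y$1 = 0")
    case True
    then have "y$2 \<noteq> 0" using assms(4) by (auto simp: vec_eq_iff forall_2)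
    then show ?thesis using det True
      by (intro exI[of _ "x$2 / y$2"]) (auto simp: vec_eq_iff forall_2)
  next
    case False
    then show ?thesis using det
      by (intro exI[of _ "x$1 / y$1"]) (auto simp: vec_eq_iff forall_2 field_simps)
  qed
qed

section \<open>The Levi form at a weakly pseudoconvex point\<close>

section \<open>Invariance of the vanishing of the Levi form\<close>

text \<open>By \<open>vf_vf_bar\<close>, since the iterated derivative of \<open>s\<close> vanishes
  on the boundary. The field is tangential for \<open>r\<close> while \<open>s\<close> is any smooth
  function that vanishes on the boundary, so one field can be used with two defining
  functions.\<close>

lemma hess_form_eq_sum_dzbar:
  assumes \<Omega>: "open \<Omega>" "local_defining_function \<Omega> p0 U r" "hol_vector_field U L" "tangential \<Omega> U r L"
    and V: "open V" "V \<subseteq> U" "smooth_on V s" "\<And>x. x \<in> frontier \<Omega> \<inter> V \<Longrightarrow> s x = 0"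
    and p: "p \<in> frontier \<Omega> \<inter> V"
  shows "hess_form s L L p = - (\<Sum>k\<in>UNIV. vf L (\<lambda>x. cnj (L x $ k)) p * dzbar k s p)"
proof -
  have "(\<lambda>x. L x $ k) differentiable (at p)" for k
    using \<Omega>(3) V(2) p smooth_on_imp_differentiable unfolding hol_vector_field_def by blast
  from vf_vf_bar[OF smooth_on_imp_twice_differentiable[OF V(1,3)] this, of L] p
    vf_zero_on_frontier(2)[OF \<Omega> V p]
  show ?thesis by (simp add: eq_neg_iff_add_eq_0)
qed

lemma hess_form_scale: "hess_form f (\<lambda>_. c *s v) (\<lambda>_. c *s v) p = c * cnj c * hess_form f (\<lambda>_. v) (\<lambda>_. v) p"
  by (simp add: hess_form_def sum_2 algebra_simps)

lemma hess_form_pointwise: "hess_form f A B p = hess_form f (\<lambda>_. A p) (\<lambda>_. B p) p"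
  by (simp add: hess_form_def)

text \<open>First \<open>s\<close> replaces \<open>r\<close> with \<open>L\<close> kept: the formula
  above is linear in the first derivatives, and those of \<open>r\<close> and \<open>s\<close> at
  \<open>p\<close> are proportional. Then \<open>M\<close> replaces \<open>L\<close>: at
  \<open>p\<close> the two fields are proportional, which multiplies the form by
  \<open>a * cnj a\<close>.\<close>

lemma levi_form_zero_invariant:
  assumes \<Omega>: "open \<Omega>"
    and r: "local_defining_function \<Omega> p U r" "hol_vector_field U L" "tangential \<Omega> U r L"
    and s: "local_defining_function \<Omega> p V s" "hol_vector_field V M" "tangential \<Omega> V s M"
    and M: "M p \<noteq> 0" "hess_form (cplx s) M M p = 0"
  shows "hess_form (cplx r) L L p = 0"
proof -
  define Y where "Y = U \<inter> V"
  have p: "p \<in> frontier \<Omega>" "p \<in> U" "p \<in> V" and opn: "open U" "open V" "open Y"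
    using r(1) s(1) by (auto simp: local_defining_function_def Y_def)
  have smr: "smooth_on U r" and sms: "smooth_on V s"
    using r(1) s(1) by (auto simp: local_defining_function_def)
  have rd: "(r has_derivative frechet_derivative r (at p)) (at p)" "r differentiable (at p)"
    using smooth_on_imp_differentiable[OF smr p(2)] by (simp_all add: frechet_derivative_works[symmetric])
  have sd: "(s has_derivative frechet_derivative s (at p)) (at p)" "s differentiable (at p)"
    using smooth_on_imp_differentiable[OF sms p(3)] by (simp_all add: frechet_derivative_works[symmetric])
  have csms: "smooth_on Y (cplx s)" and csmr: "smooth_on Y (cplx r)"
    using smooth_on_subset[OF sms, of Y] smooth_on_subset[OF smr, of Y]
    by (auto simp: Y_def intro!: smooth_on_bounded_linear[OF bounded_linear_of_real opn(3)[unfolded Y_def]])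
  have zr: "r x = 0" if "x \<in> frontier \<Omega> \<inter> U" for x
    using \<Omega> r(1) that by (rule local_defining_function_zero)
  have zs: "s x = 0" if "x \<in> frontier \<Omega> \<inter> V" for x
    using \<Omega> s(1) that by (rule local_defining_function_zero)
  have pY: "p \<in> frontier \<Omega> \<inter> Y" using p by (simp add: Y_def)
  have hs: "hess_form (cplx s) L L p = - (\<Sum>k\<in>UNIV. vf L (\<lambda>x. cnj (L x $ k)) p * dzbar k (cplx s) p)"
    by (rule hess_form_eq_sum_dzbar[OF \<Omega> r opn(3) _ csms _ pY]) (auto simp: Y_def zs)
  have hr: "hess_form (cplx r) L L p = - (\<Sum>k\<in>UNIV. vf L (\<lambda>x. cnj (L x $ k)) p * dzbar k (cplx r) p)"
    by (rule hess_form_eq_sum_dzbar[OF \<Omega> r opn(3) _ csmr _ pY]) (auto simp: Y_def zr)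
  have ds: "frechet_derivative s (at p) \<noteq> (\<lambda>_. 0)"
    using s(1) p by (auto simp: local_defining_function_def)
  have "\<exists>c. \<forall>v. frechet_derivative r (at p) v = frechet_derivative s (at p) v *\<^sub>R c"
  proof (rule linear_kernel_factor[OF has_derivative_linear[OF rd(1)] has_derivative_linear[OF sd(1)] ds])
    \<comment> \<open>The kernel of the derivative of \<open>s\<close> consists of tangent
      directions of the boundary, on which \<open>r\<close> vanishes.\<close>
    fix v assume v: "frechet_derivative s (at p) v = 0"
    have "v \<in> contingent_cone (frontier \<Omega>) p"
      by (rule local_defining_function_tangent[OF \<Omega> s(1)]) (use p v in auto)
    then show "frechet_derivative r (at p) v = 0"
      using derivative_zero_on_contingent_cone[OF rd(1) _ opn(1) p(2)] zr p by blast
  qed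
  then obtain c where c: "\<And>v. frechet_derivative r (at p) v = frechet_derivative s (at p) v *\<^sub>R c"
    by blast
  have "dzbar k (cplx r) p = c * dzbar k (cplx s) p" for k
    unfolding dzbar_def frechet_derivative_at[OF cplx_has_derivative[OF rd(2)], symmetric]
      frechet_derivative_at[OF cplx_has_derivative[OF sd(2)], symmetric]
    by (simp add: c field_simps)
  then have hrs: "hess_form (cplx r) L L p = c * hess_form (cplx s) L L p"
    unfolding hr hs by (simp add: sum_2 algebra_simps)
  \<comment> \<open>\<open>L\<close> is tangential by way of \<open>r\<close>, but \<open>s\<close>
    vanishes on the same boundary, so \<open>L\<close> annihilates \<open>s\<close> at
    \<open>p\<close> as well.\<close>
  have Lp: "vf L (cplx s) p = 0"
    by (rule vf_zero_on_frontier(1)[OF \<Omega> r opn(3) _ csms _ pY]) (auto simp: Y_def zs)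
  have Mp: "vf M (cplx s) p = 0" using s(3) p by (auto simp: tangential_def)
  have "\<exists>a. L p = a *s M p"
  proof (rule orthogonal_proportional)
    show "(\<Sum>j\<in>UNIV. L p $ j * (\<chi> j. dz j (cplx s) p) $ j) = 0"
      "(\<Sum>j\<in>UNIV. M p $ j * (\<chi> j. dz j (cplx s) p) $ j) = 0"
      using Lp Mp by (simp_all add: vf_def)
    show "(\<chi> j. dz j (cplx s) p) \<noteq> 0"
      using dz_nonzero[OF sd(2) ds] by (auto simp: vec_eq_iff)
  qed (use M(1) in auto)
  then obtain a where a: "L p = a *s M p" by blast
  have "hess_form (cplx s) L L p = a * cnj a * hess_form (cplx s) M M p"
    unfolding hess_form_pointwise[of _ L] hess_form_pointwise[of _ M] a by (rule hess_form_scale)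
  with hrs M(2) show ?thesis by simp
qed

text \<open>Failure of strictness provides some \<open>s\<close> and \<open>M\<close> whose Levi
  form is not positive throughout the boundary near \<open>p\<close>. By continuity it is not
  positive at \<open>p\<close>, and pseudoconvexity makes it zero there; invariance carries this
  over to \<open>r\<close> and \<open>L\<close>.\<close>

lemma weakly_pseudoconvex_levi_form_zero:
  assumes \<Omega>: "open \<Omega>" and wk: "weakly_pseudoconvex_at \<Omega> p"
    and r: "local_defining_function \<Omega> p U r" "hol_vector_field U L" "tangential \<Omega> U r L"
  shows "hess_form (cplx r) L L p = 0"
proof -
  obtain V s M where s: "local_defining_function \<Omega> p V s" "hol_vector_field V M" "tangential \<Omega> V s M"
    "nonvanishing_on V M"
    and freq: "\<not> (\<forall>\<^sub>F q in nhds p. q \<in> frontier \<Omega> \<longrightarrow> 0 < Re (hess_form (cplx s) M M q))"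
    using wk unfolding weakly_pseudoconvex_at_def strictly_pseudoconvex_at_def by blast
  have V: "open V" "p \<in> V" "smooth_on V s" "p \<in> frontier \<Omega>"
    using s(1) by (auto simp: local_defining_function_def)
  have "\<forall>\<^sub>F q in nhds p. q \<in> frontier \<Omega> \<longrightarrow> 0 \<le> Re (hess_form (cplx s) M M q)"
    using wk s unfolding weakly_pseudoconvex_at_def pseudoconvex_at_def by blast
  then have ge: "0 \<le> Re (hess_form (cplx s) M M p)"
    using V(4) eventually_nhds_x_imp_x by blast
  define g where "g q = Re (hess_form (cplx s) M M q)" for q
  have "continuous_on V g"
    unfolding g_def
    by (intro continuous_on_Re continuous_on_hess_form s(2) V(1)
        smooth_on_bounded_linear[OF bounded_linear_of_real V(1,3)])
  then have "isCont g p"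
    using V(1,2) continuous_on_eq_continuous_at by blast
  then have "(g \<longlongrightarrow> g p) (nhds p)"
    by (simp add: isCont_def tendsto_at_iff_tendsto_nhds)
  then have "0 < g p \<Longrightarrow> \<forall>\<^sub>F q in nhds p. 0 < g q"
    by (rule order_tendstoD(1))
  then have "\<not> 0 < Re (hess_form (cplx s) M M p)"
    using freq eventually_mono[of "\<lambda>q. 0 < g q" "nhds p" "\<lambda>q. q \<in> frontier \<Omega> \<longrightarrow> 0 < g q"]
    unfolding g_def by blast
  with ge hess_form_real[OF V(1,3,2), of M] have "hess_form (cplx s) M M p = 0"
    by (simp add: complex_eq_iff complex_is_Real_iff)
  with \<Omega> r s(1-3) V(2) s(4) show ?thesis
    by (intro levi_form_zero_invariant[of \<Omega> p U r L V s M]) (auto simp: nonvanishing_on_def)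
qed

section \<open>Positive semidefinite real quadratic forms in two variables\<close>

lemma quadratic_form_discriminant:
  fixes P Q R :: real
  assumes "\<And>a b. 0 \<le> a\<^sup>2 * P + 2 * a * b * Q + b\<^sup>2 * R"
  shows "0 \<le> P" "0 \<le> R" "Q\<^sup>2 \<le> P * R"
proof -
  show P: "0 \<le> P" and "0 \<le> R" using assms[of 1 0] assms[of 0 1] by auto
  show "Q\<^sup>2 \<le> P * R"
  proof (cases "P = 0")
    case True
    have "Q = 0"
    proof (rule ccontr)
      assume "Q \<noteq> 0"
      \<comment> \<open>For \<open>P = 0\<close> the form at \<open>b = 1\<close> is affine in
        \<open>a\<close> with slope \<open>2 * Q\<close>; this \<open>a\<close> gives it the value
        -1.\<close>
      then show False using assms[of "- (R + 1) / (2 * Q)" 1] True by (simp add: field_simps)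
    qed
    with True show ?thesis by simp
  next
    case False
    \<comment> \<open>The form at \<open>(Q, - P)\<close> equals \<open>P\<close> times the
      determinant.\<close>
    have "0 \<le> P * (P * R - Q\<^sup>2)"
      using assms[of Q "- P"] by (simp add: power2_eq_square algebra_simps)
    with P False show ?thesis by (simp add: zero_le_mult_iff)
  qed
qed

text \<open>The squares of the two sides differ by four times the determinant of the form, and the
  trace is nonnegative.\<close>

lemma cmod_diff_le_trace:
  assumes "\<And>a b. 0 \<le> a\<^sup>2 * P + 2 * a * b * Q + b\<^sup>2 * R"
  shows "cmod (of_real P - of_real R - 2 * \<i> * of_real Q) \<le> P + R"
proof (rule power2_le_imp_le)
  have "(cmod (of_real P - of_real R - 2 * \<i> * of_real Q))\<^sup>2 = (P - R)\<^sup>2 + 4 * Q\<^sup>2"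
    by (simp add: cmod_power2 power_mult_distrib)
  also have "\<dots> \<le> (P + R)\<^sup>2"
    using quadratic_form_discriminant(3)[OF assms] by (simp add: power2_eq_square algebra_simps)
  finally show "(cmod (of_real P - of_real R - 2 * \<i> * of_real Q))\<^sup>2 \<le> (P + R)\<^sup>2" .
qed (use quadratic_form_discriminant[OF assms] in simp)

section \<open>Comparison of the two iterated derivatives of the Levi function at p0\<close>

section \<open>The second-order inequality\<close>

lemma cone_nonneg_Reals: "cone (\<real>\<^sub>\<ge>\<^sub>0 :: complex set)"
  by (auto simp: cone_def scaleR_conv_of_real intro: nonneg_Reals_mult_I)

theorem theorem4p10:
  fixes \<Omega> U :: "(complex^2) set" and p0 :: "complex^2"
    and r :: "complex^2 \<Rightarrow> real" and L :: "complex^2 \<Rightarrow> complex^2"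
    and lam :: "complex^2 \<Rightarrow> complex"
  assumes "smoothly_bounded_domain \<Omega>"
    and "pseudoconvex \<Omega>"
    and "p0 \<in> frontier \<Omega>"
    and "weakly_pseudoconvex_at \<Omega> p0"
    and "local_defining_function \<Omega> p0 U r"
    and "hol_vector_field U L"
    and "tangential \<Omega> U r L"
    and "nonvanishing_on U L"
    and "extends_levi_function \<Omega> U r L lam"
  shows "vf L (vf_bar L lam) p0 \<in> \<real> \<and>
         Re (vf L (vf_bar L lam) p0) \<ge> cmod (vf L (vf L lam) p0)"
proof -
  have \<Omega>: "open \<Omega>" using assms(1) by (simp add: smoothly_bounded_domain_def)
  note r = assms(5-7)
  have U: "open U" "p0 \<in> U" "smooth_on U r"
    using r(1) by (auto simp: local_defining_function_def)
  have p0: "p0 \<in> frontier \<Omega> \<inter> U" using assms(3) U(2) by simp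
  have lam: "smooth_on U lam" "\<And>q. q \<in> frontier \<Omega> \<inter> U \<Longrightarrow> lam q = hess_form (cplx r) L L q"
    using assms(9) by (auto simp: extends_levi_function_def)
  have "\<forall>\<^sub>F q in nhds p0. q \<in> frontier \<Omega> \<longrightarrow> 0 \<le> Re (hess_form (cplx r) L L q)"
    using assms(4) r unfolding weakly_pseudoconvex_at_def pseudoconvex_at_def by blast
  then obtain N where N: "open N" "p0 \<in> N"
    "\<And>q. q \<in> N \<Longrightarrow> q \<in> frontier \<Omega> \<Longrightarrow> 0 \<le> Re (hess_form (cplx r) L L q)"
    unfolding eventually_nhds by blast
  \<comment> \<open>Pseudoconvexity gives the sign of the Levi form only near \<open>p0\<close>,
    hence the smaller neighborhood.\<close>
  define Y where "Y = U \<inter> N"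
  have Y: "open Y" "p0 \<in> Y" using U N by (auto simp: Y_def)
  have lam_nonneg: "lam q \<in> \<real>\<^sub>\<ge>\<^sub>0" if "q \<in> frontier \<Omega> \<inter> Y" for q
    using lam(2)[of q] N(3)[of q] hess_form_real[OF U(1,3), of q L] that
    by (auto simp: Y_def complex_nonneg_Reals_iff complex_is_Real_iff)
  have lam0: "lam p0 = 0"
    using lam(2)[OF p0] weakly_pseudoconvex_levi_form_zero[OF \<Omega> assms(4) r] by simp
  have rz: "r q = 0" if "q \<in> frontier \<Omega> \<inter> U" for q
    using \<Omega> r(1) that by (rule local_defining_function_zero)
  have rd: "(r has_derivative frechet_derivative r (at p0)) (at p0)"
    using smooth_on_imp_differentiable[OF U(3,2)] by (simp add: frechet_derivative_works)
  have lamd: "(lam has_derivative frechet_derivative lam (at p0)) (at p0)"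
    using smooth_on_imp_differentiable[OF lam(1) U(2)] by (simp add: frechet_derivative_works)
  have cone: "v \<in> contingent_cone (frontier \<Omega>) p0" if "frechet_derivative r (at p0) v = 0" for v
    using \<Omega> r(1) p0 that by (rule local_defining_function_tangent)
  have dlam_nonneg: "frechet_derivative lam (at p0) v \<in> \<real>\<^sub>\<ge>\<^sub>0" if "frechet_derivative r (at p0) v = 0" for v
    using lamd cone[OF that] Y lam0 closed_nonneg_Reals_complex cone_nonneg_Reals lam_nonneg
    by (rule derivative_in_closed_cone)
  have "frechet_derivative lam (at p0) v = 0" if v: "frechet_derivative r (at p0) v = 0" for v
  proof -
    \<comment> \<open>Both \<open>v\<close> and \<open>- v\<close> are tangent, so the derivative
      and its negative are nonnegative reals.\<close>
    have "frechet_derivative r (at p0) (- v) = 0"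
      using v linear_neg[OF has_derivative_linear[OF rd]] by simp
    then show ?thesis
      using dlam_nonneg[of v] dlam_nonneg[of "- v"] v linear_neg[OF has_derivative_linear[OF lamd]]
      by (simp add: complex_nonneg_Reals_iff complex_eq_iff)
  qed
  moreover have "frechet_derivative r (at p0) \<noteq> (\<lambda>_. 0)"
    using r(1) p0 by (auto simp: local_defining_function_def)
  \<comment> \<open>The Lagrange multiplier of the boundary minimum. It is complex because the
    extension \<open>lam\<close> may take nonreal values off the boundary.\<close>
  ultimately obtain \<mu> where \<mu>: "\<And>v. frechet_derivative lam (at p0) v = frechet_derivative r (at p0) v *\<^sub>R \<mu>"
    using linear_kernel_factor[OF has_derivative_linear[OF lamd] has_derivative_linear[OF rd]] by blast
  define \<rho> where "\<rho> q = r q *\<^sub>R \<mu>" for q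
  have \<rho>: "smooth_on U \<rho>" "\<And>q. q \<in> frontier \<Omega> \<inter> U \<Longrightarrow> \<rho> q = 0"
    using smooth_on_bounded_linear[OF bounded_linear_scaleR_left[of \<mu>] U(1,3)] rz
    by (simp_all add: \<rho>_def[abs_def])
  \<comment> \<open>\<open>W\<close> has the boundary values of \<open>lam\<close> but a vanishing
    full derivative at \<open>p0\<close>, as the second-order limit requires.\<close>
  define W where "W q = lam q - \<rho> q" for q
  have W: "smooth_on U W" "twice_differentiable_at W p0"
    using smooth_on_diff[OF U(1) lam(1) \<rho>(1)] smooth_on_imp_twice_differentiable[OF U(1) _ U(2)]
    by (auto simp: W_def[abs_def])
  have WF: "W q = lam q" if "q \<in> frontier \<Omega> \<inter> U" for q
    using \<rho>(2)[OF that] by (simp add: W_def)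
  have "(W has_derivative (\<lambda>v. frechet_derivative lam (at p0) v - frechet_derivative r (at p0) v *\<^sub>R \<mu>)) (at p0)"
    unfolding W_def[abs_def] \<rho>_def by (intro has_derivative_diff lamd has_derivative_scaleR_left rd)
  then have crit: "frechet_derivative W (at p0) = (\<lambda>_. 0)"
    by (simp add: frechet_derivative_at[symmetric] \<mu>)
  have tan: "vf L (cplx r) q = 0" if "q \<in> frontier \<Omega> \<inter> U" for q
    using r(3) that by (simp add: tangential_def)
  have first: "vf L lam q = vf L W q" "vf_bar L lam q = vf_bar L W q" if q: "q \<in> frontier \<Omega> \<inter> U" for q
    using vf_eq_on_frontier[OF \<Omega> r(1) q tan[OF q], of lam W U] q U(1) WF
      smooth_on_imp_differentiable[OF lam(1), of q] smooth_on_imp_differentiable[OF W(1), of q] by auto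
  \<comment> \<open>\<open>first\<close> holds on the whole boundary inside \<open>U\<close>, so a
    further derivative along \<open>L\<close> again sees equal functions.\<close>
  have second: "vf L (vf_bar L lam) p0 = vf L (vf_bar L W) p0" "vf L (vf L lam) p0 = vf L (vf L W) p0"
    using vf_eq_on_frontier(1)[OF \<Omega> r(1) p0 tan[OF p0] _ _ U(1,2)] first
      vf_differentiable[OF U(1) r(2) lam(1) U(2)] vf_differentiable[OF U(1) r(2) W(1) U(2)] by metis+
  define D where "D = second_derivative W p0"
  define a where "a = L p0"
  \<comment> \<open>With \<open>a\<close> this gives the two real directions on which every (1,0)
    computation for \<open>L\<close> at \<open>p0\<close> rests; both are tangent.\<close>
  define b where "b = \<i> *s a"
  have Dl: "linear (\<lambda>u. D u v)" and Dr: "linear (D v)" for v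
    using bounded_linear_second_derivative[OF W(2)] linear_second_derivative[OF W(2)]
    by (auto simp: D_def bounded_linear.linear)
  have sym: "D b a = D a b" unfolding D_def by (rule second_derivative_sym[OF W(2)])
  have ab: "frechet_derivative r (at p0) a = 0" "frechet_derivative r (at p0) b = 0"
    using tan[OF p0] smooth_on_imp_differentiable[OF U(3,2)] by (simp_all add: a_def b_def vf_cplx_eq_0_iff)
  have D_nonneg: "D v v \<in> \<real>\<^sub>\<ge>\<^sub>0" if "frechet_derivative r (at p0) v = 0" for v
    unfolding D_def
    using W(2) crit cone[OF that] Y _ closed_nonneg_Reals_complex cone_nonneg_Reals
  proof (rule second_derivative_in_closed_cone)
    show "W p0 = 0" using WF[OF p0] lam0 by simp
    show "W x \<in> \<real>\<^sub>\<ge>\<^sub>0" if "x \<in> frontier \<Omega> \<inter> Y" for x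
      using WF[of x] lam_nonneg[OF that] that by (simp add: Y_def)
  qed
  have quad: "of_real (x\<^sup>2) * D a a + 2 * of_real (x * y) * D a b + of_real (y\<^sup>2) * D b b \<in> \<real>\<^sub>\<ge>\<^sub>0" for x y
  proof -
    have "frechet_derivative r (at p0) (x *\<^sub>R a + y *\<^sub>R b) = 0"
      using has_derivative_linear[OF rd] ab by (simp add: linear_add linear_scale)
    from D_nonneg[OF this]
    have "x *\<^sub>R (x *\<^sub>R D a a + y *\<^sub>R D a b) + y *\<^sub>R (x *\<^sub>R D a b + y *\<^sub>R D b b) \<in> \<real>\<^sub>\<ge>\<^sub>0"
      by (simp only: linear_add[OF Dl] linear_scale[OF Dl] linear_add[OF Dr] linear_scale[OF Dr] sym)
    then show ?thesis
      by (simp add: scaleR_conv_of_real power2_eq_square algebra_simps)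
  qed
  \<comment> \<open>\<open>D\<close> is complex-valued a priori; the form at (1,0), (0,1) and (1,1)
    being real determines the three imaginary parts.\<close>
  have im: "Im (D a a) = 0" "Im (D b b) = 0" "Im (D a b) = 0"
    using quad[of 1 0] quad[of 0 1] quad[of 1 1] by (auto simp: complex_nonneg_Reals_iff)
  define P Q R where "P = Re (D a a)" and "Q = Re (D a b)" and "R = Re (D b b)"
  have PQR: "D a a = of_real P" "D a b = of_real Q" "D b b = of_real R"
    using im by (simp_all add: P_def Q_def R_def complex_eq_iff)
  have psd: "0 \<le> x\<^sup>2 * P + 2 * x * y * Q + y\<^sup>2 * R" for x y
    using quad[of x y] by (simp add: complex_nonneg_Reals_iff PQR)
  have Ld: "(\<lambda>x. L x $ k) differentiable (at p0)" for k
    using r(2) U(2) smooth_on_imp_differentiable unfolding hol_vector_field_def by blast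
  have "dzbar k W p0 = 0" for k by (simp add: dzbar_def crit)
  \<comment> \<open>The derivatives of the coefficients of \<open>L\<close> drop out since
    \<open>W\<close> is critical at \<open>p0\<close>, and the mixed terms \<open>D a b\<close> and
    \<open>D b a\<close> cancel.\<close>
  then have LLbar: "vf L (vf_bar L lam) p0 = of_real ((P + R) / 4)"
    unfolding second(1) vf_vf_bar[OF W(2) Ld] hess_form_eq[OF W(2)]
    by (simp add: D_def[symmetric] a_def[symmetric] b_def[symmetric] sym PQR)
  have "vf L (vf L lam) p0 = (of_real P - of_real R - 2 * \<i> * of_real Q) / 4"
    unfolding second(2) vf_vf_critical[OF W(2) Ld crit]
    by (simp add: D_def[symmetric] a_def[symmetric] b_def[symmetric] sym PQR)
  then have "cmod (vf L (vf L lam) p0) = cmod (of_real P - of_real R - 2 * \<i> * of_real Q) / 4"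
    by (simp only: norm_divide norm_numeral)
  also have "\<dots> \<le> (P + R) / 4"
    using cmod_diff_le_trace[OF psd] by (rule divide_right_mono) simp
  finally have "cmod (vf L (vf L lam) p0) \<le> (P + R) / 4" .
  then show ?thesis by (simp only: LLbar Re_complex_of_real Reals_of_real simp_thms)
qed

end
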